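(* Consider the data model $y_i=\theta_{0,i}+\epsilon_i$, $i=1,\ldots,n$, where $\epsilon_1,\ldots,\epsilon_n$ are i.i.d. sub-Gaussian errors, i.e., $\mathbb{E}(\epsilon_i)=0$ and $\mathbb{P}(|\epsilon_i|>u)\le M\exp(-u^2/(2\sigma^2))$ for all $u\ge0$, for constants $M,\sigma>0$, and where $\theta_0\in\mathrm{BD}_G(s)$ for a connected undirected graph $G$ on $V=\{1,\ldots,n\}$. Consider an arbitrary DFS ordering of $G$, that defines a permutation matrix $P$ and the DFS fused lasso estimator $$\hat\theta_{\mathrm{DFS}}=\operatorname*{argmin}_{\theta\in\mathbb{R}^n}\ \tfrac12\|y-\theta\|_2^2+\lambda\|\nabla_{\mathrm{1d}}P\theta\|_1.$$ Denote by $$W_n=\min\{|i-j|: i\ne j,\ (\nabla_{\mathrm{1d}}P\theta_0)_i\ne0,\ (\nabla_{\mathrm{1d}}P\theta_0)_j\ne0\}$$ the minimum distance between positions, measured along the DFS-induced chain, at which nonzero differences (jumps) occur in $\theta_0$. Then, under a choice of tuning parameter $\lambda\asymp(nW_n)^{1/4}$, the DFS fused lasso estimator has mean squared error converging in probability at the rate $$\|\hat\theta_{\mathrm{DFS}}-\theta_0\|_n^2=O_{\mathbb{P}}\left(\frac{s}{n}\Big((\log s+\log\log n)\log n+\sqrt{n/W_n}\Big)\right).$$ Hence, if the $s$ jumps along the DFS chain are evenly spaced apart, i.e., $W_n\asymp n/s$, then for $\lambda\asymp\sqrt{n}\,s^{-1/4}$, $$\|\hat\theta_{\mathrm{DFS}}-\theta_0\|_n^2=O_{\mathbb{P}}\left(\frac{s(\log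 s+\log\log n)\log n}{n}+\frac{s^{3/2}}{n}\right).$$
   Context: For a graph $G=(V,E)$ with each edge $e$ arbitrarily oriented with endpoints $e^+,e^-$, $\|\nabla_G\theta\|_0=\sum_{e\in E}1\{\theta_{e^+}\ne\theta_{e^-}\}$, and for a sparsity parameter $s>0$, $\mathrm{BD}_G(s)=\{\theta\in\mathbb{R}^n:\|\nabla_G\theta\|_0\le s\}$. $\nabla_{\mathrm{1d}}\in\mathbb{R}^{(n-1)\times n}$ is the first difference matrix, $(\nabla_{\mathrm{1d}}x)_i=x_{i+1}-x_i$. A DFS ordering is the list $v_1,\ldots,v_n$ of nodes in the order in which they are reached by a run of depth-first search on $G$, and the associated permutation matrix $P$ is defined by $(P\theta)_i=\theta_{v_i}$; the DFS-induced chain is the path graph $v_1 - v_2 - \cdots - v_n$. $\|x\|_n^2=\|x\|_2^2/n$. $a_n=O(b_n)$ means $a_n/b_n$ is upper bounded for $n$ large enough; $a_n\asymp b_n$ means both $a_n=O(b_n)$ and $a_n^{-1}=O(b_n^{-1})$; $A_n=O_{\mathbb{P}}(B_n)$ means that $A_n/B_n$ is bounded in probability.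
   Formalization: W_n is taken as the minimum distance among the jump positions together with the two ends 0 and n of the DFS chain; with interior jumps only, the rate fails when a large jump lies very near an end, and W_n is undefined for fewer than two jumps. *)

theory Defs
  imports "HOL-Probability.Probability" "HOL-Library.Landau_Symbols"
begin

text \<open>
  Vectors in \<open>\<real>\<^sup>n\<close> are functions \<open>nat \<Rightarrow> real\<close> read on the index set \<open>{1..n}\<close>; values
  outside it never enter any definition below.
\<close>

subsection \<open>Graphs and bounded-difference classes\<close>

text \<open>A finite simple undirected graph on \<open>V\<close> is given by its set of two-element edges.\<close>

definition simple_graph :: "'a set \<Rightarrow> 'a set set \<Rightarrow> bool" where
  "simple_graph V E \<longleftrightarrow> finite V \<and> (\<forall>e\<in>E. e \<subseteq> V \<and> card e = 2)"

definition adjacent :: "'a set set \<Rightarrow> 'a \<Rightarrow> 'a \<Rightarrow> bool" where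
  "adjacent E u v \<longleftrightarrow> {u, v} \<in> E"

definition connected_graph :: "'a set \<Rightarrow> 'a set set \<Rightarrow> bool" where
  "connected_graph V E \<longleftrightarrow>
     simple_graph V E \<and> V \<noteq> {} \<and> (\<forall>u\<in>V. \<forall>v\<in>V. (adjacent E)\<^sup>*\<^sup>* u v)"

text \<open>The count does not depend on how the edges are oriented, so no orientation is chosen.\<close>

definition grad_l0 :: "'a set set \<Rightarrow> ('a \<Rightarrow> real) \<Rightarrow> nat" where
  "grad_l0 E \<theta> = card {e \<in> E. \<exists>u v. e = {u, v} \<and> \<theta> u \<noteq> \<theta> v}"

definition BD :: "'a set set \<Rightarrow> nat \<Rightarrow> ('a \<Rightarrow> real) set" where
  "BD E s = {\<theta>. grad_l0 E \<theta> \<le> s}"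

subsection \<open>Depth-first search\<close>

text \<open>
  A state is the list of nodes reached so far, in order, together with the stack of active
  nodes. The choice among unreached neighbours is left open, so that every run is covered.
\<close>

inductive dfs_step ::
  "'a set set \<Rightarrow> 'a list \<times> 'a list \<Rightarrow> 'a list \<times> 'a list \<Rightarrow> bool" for E where
  visit: "\<lbrakk>adjacent E u v; v \<notin> set vs\<rbrakk> \<Longrightarrow> dfs_step E (vs, u # us) (vs @ [v], v # u # us)"
| backtrack: "(\<And>v. adjacent E u v \<Longrightarrow> v \<in> set vs) \<Longrightarrow> dfs_step E (vs, u # us) (vs, us)"

definition dfs_ordering :: "'a set \<Rightarrow> 'a set set \<Rightarrow> 'a list \<Rightarrow> bool" where
  "dfs_ordering V E vs \<longleftrightarrow> (\<exists>r\<in>V. (dfs_step E)\<^sup>*\<^sup>* ([r], [r]) (vs, []))"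

subsection \<open>The DFS fused lasso\<close>

text \<open>The action of the permutation matrix; lists are indexed from 0, vectors from 1.\<close>

definition permute :: "'a list \<Rightarrow> ('a \<Rightarrow> real) \<Rightarrow> nat \<Rightarrow> real" where
  "permute vs \<theta> i = \<theta> (vs ! (i - 1))"

text \<open>The first difference operator; its \<open>n - 1\<close> rows are the indices \<open>1..<n\<close>.\<close>

definition diff1 :: "(nat \<Rightarrow> real) \<Rightarrow> nat \<Rightarrow> real" where
  "diff1 x i = x (i + 1) - x i"

definition dfs_fused_lasso_objective ::
  "nat \<Rightarrow> nat list \<Rightarrow> real \<Rightarrow> (nat \<Rightarrow> real) \<Rightarrow> (nat \<Rightarrow> real) \<Rightarrow> real" where
  "dfs_fused_lasso_objective n vs lam y \<theta> =
     1 / 2 * (\<Sum>i = 1..n. (y i - \<theta> i)\<^sup>2) + lam * (\<Sum>i = 1..<n. \<bar>diff1 (permute vs \<theta>) i\<bar>)"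

definition is_dfs_fused_lasso ::
  "nat \<Rightarrow> nat list \<Rightarrow> real \<Rightarrow> (nat \<Rightarrow> real) \<Rightarrow> (nat \<Rightarrow> real) \<Rightarrow> bool" where
  "is_dfs_fused_lasso n vs lam y \<theta> \<longleftrightarrow>
     is_arg_min (dfs_fused_lasso_objective n vs lam y) (\<lambda>_. True) \<theta>"

definition mean_sq :: "nat \<Rightarrow> (nat \<Rightarrow> real) \<Rightarrow> real" where
  "mean_sq n x = (\<Sum>i = 1..n. (x i)\<^sup>2) / real n"

subsection \<open>Spacing of the jumps along the chain\<close>

definition jumps :: "nat \<Rightarrow> nat list \<Rightarrow> (nat \<Rightarrow> real) \<Rightarrow> nat set" where
  "jumps n vs \<theta> = {i \<in> {1..<n}. diff1 (permute vs \<theta>) i \<noteq> 0}"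

definition min_distance :: "nat set \<Rightarrow> nat" where
  "min_distance S = Min {nat \<bar>int i - int j\<bar> | i j. i \<in> S \<and> j \<in> S \<and> i \<noteq> j}"

text \<open>
  The two ends \<open>0\<close> and \<open>n\<close> of the chain are counted among the positions, so that the spacing
  is the length of the shortest constancy block. Without them the minimum is over the empty set
  when there are fewer than two jumps, and the error rate fails when a jump is much closer to an
  end of the chain than to the other jumps: a block of length \<open>L\<close> at an end incurs a squared
  bias of order \<open>lam\<^sup>2 / L\<close>. When no jump is closer to an end than the jumps are to each other,
  the ends do not matter (lemma \<open>jump_spacing_eq\<close>).
\<close>

definition jump_spacing :: "nat \<Rightarrow> nat list \<Rightarrow> (nat \<Rightarrow> real) \<Rightarrow> nat" where
  "jump_spacing n vs \<theta> = min_distance (jumps n vs \<theta> \<union> {0, n})"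

lemma jump_spacing_eq:
  assumes two: "2 \<le> card (jumps n vs \<theta>)"
    and ends: "\<And>i. i \<in> jumps n vs \<theta> \<Longrightarrow>
      min_distance (jumps n vs \<theta>) \<le> i \<and> min_distance (jumps n vs \<theta>) \<le> n - i"
  shows "jump_spacing n vs \<theta> = min_distance (jumps n vs \<theta>)"
proof -
  define J where "J = jumps n vs \<theta>"
  define D where "D S = {nat \<bar>int i - int j\<bar> | i j. i \<in> S \<and> j \<in> S \<and> i \<noteq> j}" for S :: "nat set"
  have m: "min_distance S = Min (D S)" for S
    by (simp add: min_distance_def D_def)
  have fin: "finite (D S)" if "finite S" for S
  proof -
    have "D S \<subseteq> (\<lambda>(i, j). nat \<bar>int i - int j\<bar>) ` (S \<times> S)"
      by (auto simp: D_def)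
    then show ?thesis
      using that by (meson finite_SigmaI finite_imageI finite_subset)
  qed
  have J: "finite J" "J \<subseteq> {1..<n}"
    by (auto simp: J_def jumps_def)
  have "\<exists>a\<in>J. \<exists>b\<in>J. a \<noteq> b"
  proof (rule ccontr)
    assume "\<not> ?thesis"
    then have "card J \<le> Suc 0"
      using card_le_Suc0_iff_eq[OF J(1)] by blast
    then show False
      using two by (simp add: J_def)
  qed
  then obtain a b where ab: "a \<in> J" "b \<in> J" "a \<noteq> b"
    by blast
  have ne: "D J \<noteq> {}"
    using ab by (auto simp: D_def)
  have sub: "D J \<subseteq> D (J \<union> {0, n})"
    by (auto simp: D_def)
  have e: "Min (D J) \<le> i \<and> Min (D J) \<le> n - i" if "i \<in> J" for i
    using ends[of i] that by (simp add: J_def m)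
  have "Min (D J) \<le> d" if d: "d \<in> D (J \<union> {0, n})" for d
  proof -
    obtain i j where ij: "i \<in> J \<union> {0, n}" "j \<in> J \<union> {0, n}" "i \<noteq> j" "d = nat \<bar>int i - int j\<bar>"
      using d unfolding D_def by blast
    show ?thesis
    proof (cases "i \<in> J \<and> j \<in> J")
      case True
      then have "d \<in> D J"
        using ij by (auto simp: D_def)
      then show ?thesis
        using fin[OF J(1)] by simp
    next
      case False
      have n: "Min (D J) \<le> n"
        using e[OF ab(1)] by linarith
      have k: "Min (D J) \<le> k \<and> Min (D J) \<le> n - k \<and> k < n" if "k \<in> J" for k
        using e[OF that] J(2) that by auto
      consider "i \<in> J" "j = 0 \<or> j = n" | "j \<in> J" "i = 0 \<or> i = n"
        | "i = 0 \<and> j = n \<or> i = n \<and> j = 0"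
        using ij(1-3) False by blast
      then show ?thesis
      proof cases
        case 1
        then show ?thesis
          using k[OF 1(1)] ij(4) by auto
      next
        case 2
        then show ?thesis
          using k[OF 2(1)] ij(4) by auto
      next
        case 3
        then show ?thesis
          using n ij(4) by auto
      qed
    qed
  qed
  then have "Min (D J) \<le> Min (D (J \<union> {0, n}))"
    using fin[of "J \<union> {0, n}"] J(1) ne sub by (intro Min.boundedI) auto
  moreover have "Min (D (J \<union> {0, n})) \<le> Min (D J)"
    using Min_antimono[OF sub ne] fin[of "J \<union> {0, n}"] J(1) by simp
  ultimately have "Min (D (J \<union> {0, n})) = Min (D J)"
    by (rule antisym[rotated])
  then show ?thesis
    by (simp add: jump_spacing_def m J_def)
qed

subsection \<open>Stochastic order\<close>

text \<open>
  \<open>X n = O\<^sub>P(b n)\<close>. The exceptional event is covered by a measurable one, since \<open>measure\<close> returns 0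
  on non-measurable sets; for measurable \<open>X\<close> the cover may be taken to be the event itself.
\<close>

definition bounded_in_prob ::
  "(nat \<Rightarrow> 'w measure) \<Rightarrow> (nat \<Rightarrow> 'w \<Rightarrow> real) \<Rightarrow> (nat \<Rightarrow> real) \<Rightarrow> bool" where
  "bounded_in_prob P X b \<longleftrightarrow>
     (\<forall>\<eta>>0. \<exists>C>0. \<forall>\<^sub>F n in sequentially.
        \<exists>A\<in>sets (P n). {\<omega> \<in> space (P n). \<bar>X n \<omega>\<bar> > C * \<bar>b n\<bar>} \<subseteq> A \<and> measure (P n) A \<le> \<eta>)"

definition iid_sub_gaussian ::
  "'w measure \<Rightarrow> real \<Rightarrow> real \<Rightarrow> nat \<Rightarrow> (nat \<Rightarrow> 'w \<Rightarrow> real) \<Rightarrow> bool" where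
  "iid_sub_gaussian P M \<sigma> n \<epsilon> \<longleftrightarrow>
     prob_space.indep_vars P (\<lambda>_. borel) \<epsilon> {1..n} \<and>
     (\<forall>i\<in>{1..n}. \<forall>j\<in>{1..n}. distr P borel (\<epsilon> i) = distr P borel (\<epsilon> j)) \<and>
     (\<forall>i\<in>{1..n}. integrable P (\<epsilon> i) \<and> integral\<^sup>L P (\<epsilon> i) = 0 \<and>
        (\<forall>u\<ge>0. measure P {\<omega> \<in> space P. \<bar>\<epsilon> i \<omega>\<bar> > u} \<le> M * exp (- u\<^sup>2 / (2 * \<sigma>\<^sup>2))))"

end

theory Submission
  imports Defs
begin

text \<open>
  Along a depth-first search every tree edge is crossed at most twice, so \<open>\<theta>0\<close> has at most \<open>2 * s\<close>
  jumps along the chain. Write \<open>x\<close> for the estimation error and \<open>e\<close> for the noise, both in the order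
  of the chain. The basic inequality bounds half the squared norm of \<open>x\<close> by \<open>\<langle>e, x\<rangle>\<close> plus the drop in
  penalty. An interpolating dual vector \<open>q\<close>, equal to the signs of the jumps and decaying to \<open>0\<close> within
  distance \<open>W / 2\<close> of them, turns this drop into a bias term of squared norm at most a multiple of
  \<open>s * (lam\<^sup>2 / W + ln n)\<close> and leaves the weighted variation
  \<open>lam * (\<Sum>t. (1 - \<bar>q t\<bar>) * \<bar>x t - x (t - 1)\<bar>)\<close> to absorb noise.

  The noise term is expanded in the Haar basis. A Haar coefficient of \<open>x\<close> on a dyadic block of length
  \<open>l\<close> is at most \<open>sqrt l\<close> times the variation of \<open>x\<close> on the block, so the part of the noise coefficient
  below a threshold \<open>\<tau>\<close> is absorbed as long as the sum of \<open>\<tau> * sqrt l\<close> over the blocks containing a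
  given edge stays below the weight of that edge. With \<open>D\<close> the minimum of \<open>lam\<^sup>2\<close> and the distance of the
  block to the jumps, \<open>\<tau> = const * (D / l) powr (1 / 4)\<close> for \<open>l \<le> D\<close> and \<open>\<tau> = 0\<close> otherwise achieves
  this. The excess over the thresholds has second moment at most a multiple of \<open>min 1 ((l / D)\<^sup>2)\<close> per
  block, which sums to a multiple of \<open>s * ln n + n / lam\<^sup>2\<close>. Markov's inequality finishes the proof,
  with \<open>s / n * (ln n + sqrt (n / W))\<close> as the resulting rate.
\<close>

subsection \<open>Jumps along a depth-first search ordering\<close>

text \<open>Defined on lists, so that one count serves both the list of reached nodes and the stack
  of active ones.\<close>

fun chain_jumps :: "('a \<Rightarrow> real) \<Rightarrow> 'a list \<Rightarrow> nat" where
  "chain_jumps \<theta> (u # v # xs) = of_bool (\<theta> u \<noteq> \<theta> v) + chain_jumps \<theta> (v # xs)"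
| "chain_jumps \<theta> _ = 0"

lemma chain_jumps_snoc:
  "xs \<noteq> [] \<Longrightarrow> chain_jumps \<theta> (xs @ [v]) = chain_jumps \<theta> xs + of_bool (\<theta> (last xs) \<noteq> \<theta> v)"
  by (induction \<theta> xs rule: chain_jumps.induct) auto

lemma chain_jumps_conv_card:
  "chain_jumps \<theta> xs = card {i \<in> {1..<length xs}. \<theta> (xs ! i) \<noteq> \<theta> (xs ! (i - 1))}"
proof (induction xs rule: rev_induct)
  case (snoc v xs)
  show ?case
  proof (cases "xs = []")
    case False
    let ?A = "\<lambda>xs. {i \<in> {1..<length xs}. \<theta> (xs ! i) \<noteq> \<theta> (xs ! (i - 1))}"
    let ?B = "if \<theta> (last xs) \<noteq> \<theta> v then {length xs} else {}"
    have "?A (xs @ [v]) = ?A xs \<union> ?B"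
      using False by (auto simp: nth_append last_conv_nth less_Suc_eq)
    moreover have "card (?A xs \<union> ?B) = card (?A xs) + card ?B"
      by (rule card_Un_disjoint) auto
    ultimately show ?thesis
      using snoc False by (simp add: chain_jumps_snoc)
  qed simp
qed simp

definition cut_within :: "'a set set \<Rightarrow> ('a \<Rightarrow> real) \<Rightarrow> 'a set \<Rightarrow> 'a set set" where
  "cut_within E \<theta> A = {e \<in> E. e \<subseteq> A \<and> (\<exists>u v. e = {u, v} \<and> \<theta> u \<noteq> \<theta> v)}"

text \<open>Since \<open>v\<close> is new, \<open>{u, v}\<close> is not contained in
  \<open>A\<close>; if the values at its ends differ, it is one more cut edge.\<close>

lemma cut_within_insert:
  assumes "finite E" "{u, v} \<in> E" "u \<in> A" "v \<notin> A"
  shows "card (cut_within E \<theta> A) + of_bool (\<theta> u \<noteq> \<theta> v) \<le> card (cut_within E \<theta> (insert v A))"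
proof (cases "\<theta> u = \<theta> v")
  case True
  then show ?thesis
    using assms by (auto simp: cut_within_def intro!: card_mono)
next
  case False
  have "card (insert {u, v} (cut_within E \<theta> A)) \<le> card (cut_within E \<theta> (insert v A))"
    using assms False by (intro card_mono) (auto simp: cut_within_def)
  moreover have "{u, v} \<notin> cut_within E \<theta> A"
    using assms by (auto simp: cut_within_def)
  ultimately show ?thesis
    using assms False by (simp add: cut_within_def)
qed

text \<open>
  Walking along the search tree crosses every tree edge at most twice, and those on the stack only
  once so far; the last conjunct keeps this account.
\<close>

definition dfs_inv :: "'a set \<Rightarrow> 'a set set \<Rightarrow> ('a \<Rightarrow> real) \<Rightarrow> 'a list \<times> 'a list \<Rightarrow> bool" where
  "dfs_inv V E \<theta> st \<longleftrightarrow> (case st of (vs, us) \<Rightarrow>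
     vs \<noteq> [] \<and> distinct vs \<and> set vs \<subseteq> V \<and> set us \<subseteq> set vs \<and>
     (\<forall>u v. u \<in> set vs - set us \<longrightarrow> adjacent E u v \<longrightarrow> v \<in> set vs) \<and>
     chain_jumps \<theta> vs + (if us = [] then 0 else of_bool (\<theta> (last vs) \<noteq> \<theta> (hd us)))
       + chain_jumps \<theta> us \<le> 2 * card (cut_within E \<theta> (set vs)))"

text \<open>A visit takes the detour from \<open>last vs\<close> over \<open>u\<close> to
  \<open>v\<close>: the edge \<open>{u, v}\<close> is charged twice, once for the list and once for
  the stack. A backtrack takes the detour over \<open>u\<close> to the next stack node, and the
  stack releases the edge that pays for it.\<close>

lemma dfs_step_inv:
  assumes "dfs_step E st st'" "dfs_inv V E \<theta> st" "simple_graph V E"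
  shows "dfs_inv V E \<theta> st'"
  using assms
proof cases
  case (visit u v vs us)
  have fin: "finite E"
    using assms(3) finite_subset[of E "Pow V"] by (auto simp: simple_graph_def)
  have uv: "{u, v} \<in> E" "u \<in> set vs" "v \<in> V"
    using visit assms by (auto simp: adjacent_def dfs_inv_def simple_graph_def)
  have "card (cut_within E \<theta> (set vs)) + of_bool (\<theta> u \<noteq> \<theta> v)
      \<le> card (cut_within E \<theta> (insert v (set vs)))"
    using cut_within_insert[OF fin uv(1,2)] visit by simp
  moreover have "of_bool (\<theta> (last vs) \<noteq> \<theta> v)
      \<le> of_bool (\<theta> (last vs) \<noteq> \<theta> u) + (of_bool (\<theta> u \<noteq> \<theta> v) :: nat)"
    by auto
  ultimately show ?thesis
    using visit assms(2) uv by (auto simp: dfs_inv_def chain_jumps_snoc)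
next
  case (backtrack u vs us)
  show ?thesis
  proof (cases us)
    case Nil
    then show ?thesis
      using backtrack assms(2) by (auto simp: dfs_inv_def)
  next
    case (Cons w ws)
    have tri: "of_bool (\<theta> (last vs) \<noteq> \<theta> w)
        \<le> of_bool (\<theta> (last vs) \<noteq> \<theta> u) + (of_bool (\<theta> u \<noteq> \<theta> w) :: nat)"
      by auto
    from Cons show ?thesis
      using backtrack assms(2) tri by (auto simp: dfs_inv_def)
  qed
qed

lemma dfs_ordering_inv:
  assumes "simple_graph V E" "dfs_ordering V E vs"
  shows "dfs_inv V E \<theta> (vs, [])"
proof -
  obtain r where r: "r \<in> V" "(dfs_step E)\<^sup>*\<^sup>* ([r], [r]) (vs, [])"
    using assms(2) by (auto simp: dfs_ordering_def)
  have "dfs_inv V E \<theta> ([r], [r])"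
    using r(1) by (auto simp: dfs_inv_def)
  with r(2) show ?thesis
    by (induction rule: rtranclp_induct) (auto intro: dfs_step_inv assms(1))
qed

text \<open>With an empty stack the invariant says that the reached set is closed under adjacency,
  so connectivity makes it all of \<open>V\<close>.\<close>

lemma dfs_ordering_set:
  assumes "connected_graph V E" "dfs_ordering V E vs"
  shows "distinct vs" "set vs = V"
proof -
  have sg: "simple_graph V E"
    using assms(1) by (simp add: connected_graph_def)
  note inv = dfs_ordering_inv[OF sg assms(2), of "\<lambda>_. 0"]
  show "distinct vs"
    using inv by (simp add: dfs_inv_def)
  obtain r where r: "r \<in> set vs"
    using inv that[OF list.set_sel(1)] by (simp add: dfs_inv_def)
  have "v \<in> set vs" if "(adjacent E)\<^sup>*\<^sup>* r v" for v
    using that r inv by (induction rule: rtranclp_induct) (auto simp: dfs_inv_def)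
  moreover have "r \<in> V"
    using r inv by (auto simp: dfs_inv_def)
  ultimately have "V \<subseteq> set vs"
    using assms(1) by (auto simp: connected_graph_def)
  then show "set vs = V"
    using inv by (auto simp: dfs_inv_def)
qed

text \<open>Once the stack is empty, the last two summands of the account in \<open>dfs_inv\<close>
  vanish.\<close>

lemma dfs_ordering_chain_jumps:
  assumes "simple_graph V E" "dfs_ordering V E vs"
  shows "chain_jumps \<theta> vs \<le> 2 * grad_l0 E \<theta>"
proof -
  have "finite E"
    using assms(1) finite_subset[of E "Pow V"] by (auto simp: simple_graph_def)
  then have "card (cut_within E \<theta> (set vs)) \<le> grad_l0 E \<theta>"
    unfolding grad_l0_def cut_within_def by (intro card_mono) auto
  then show ?thesis
    using dfs_ordering_inv[OF assms, of \<theta>] by (auto simp: dfs_inv_def)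
qed

lemma card_jumps_dfs_le:
  assumes "connected_graph {1..n} E" "dfs_ordering {1..n} E vs" "\<theta> \<in> BD E s"
  shows "card (jumps n vs \<theta>) \<le> 2 * s"
proof -
  have "length vs = n"
    using dfs_ordering_set[OF assms(1,2)] distinct_card by fastforce
  \<comment> \<open>Row \<open>i\<close> of the difference operator compares the list entries
    \<open>i - 1\<close> and \<open>i\<close>, so a jump index is the 0-based list position of the
    right end of its edge.\<close>
  then have "jumps n vs \<theta> = {i \<in> {1..<length vs}. \<theta> (vs ! i) \<noteq> \<theta> (vs ! (i - 1))}"
    by (auto simp: jumps_def diff1_def permute_def)
  then have "card (jumps n vs \<theta>) = chain_jumps \<theta> vs"
    by (simp add: chain_jumps_conv_card)
  also have "\<dots> \<le> 2 * grad_l0 E \<theta>"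
    using assms by (intro dfs_ordering_chain_jumps) (auto simp: connected_graph_def)
  finally show ?thesis
    using assms(3) by (simp add: BD_def)
qed

section \<open>Distances between positions on the chain\<close>

lemma min_distance_le:
  assumes "finite S" "i \<in> S" "j \<in> S" "i \<noteq> j"
  shows "min_distance S \<le> nat \<bar>int i - int j\<bar>"
proof -
  have "{nat \<bar>int i - int j\<bar> | i j. i \<in> S \<and> j \<in> S \<and> i \<noteq> j}
      \<subseteq> (\<lambda>(i, j). nat \<bar>int i - int j\<bar>) ` (S \<times> S)"
    by auto
  then have "finite {nat \<bar>int i - int j\<bar> | i j. i \<in> S \<and> j \<in> S \<and> i \<noteq> j}"
    by (rule finite_subset) (use assms in auto)
  then show ?thesis
    unfolding min_distance_def using assms by (intro Min_le) auto
qed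

lemma min_distance_pos:
  assumes "finite S" "i \<in> S" "j \<in> S" "i \<noteq> j"
  shows "0 < min_distance S"
proof -
  let ?D = "{nat \<bar>int i - int j\<bar> | i j. i \<in> S \<and> j \<in> S \<and> i \<noteq> j}"
  have "?D \<subseteq> (\<lambda>(i, j). nat \<bar>int i - int j\<bar>) ` (S \<times> S)"
    by auto
  then have "finite ?D"
    by (rule finite_subset) (use assms in auto)
  moreover have "?D \<noteq> {}"
    using assms by auto
  ultimately have "Min ?D \<in> ?D"
    by (rule Min_in)
  then show ?thesis
    unfolding min_distance_def by auto
qed

subsection \<open>Haar coefficients\<close>

definition block_sum :: "(nat \<Rightarrow> real) \<Rightarrow> nat \<Rightarrow> nat \<Rightarrow> real" where
  "block_sum x j p = (\<Sum>i = p * 2 ^ j..<Suc p * 2 ^ j. x i)"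

text \<open>The inner product of \<open>x\<close> with the normalised Haar function of the
  \<open>p\<close>-th dyadic block of length \<open>2 ^ Suc j\<close>; \<open>j\<close> is the level
  of the two halves.\<close>

definition haar :: "(nat \<Rightarrow> real) \<Rightarrow> nat \<Rightarrow> nat \<Rightarrow> real" where
  "haar x j p = (block_sum x j (2 * p) - block_sum x j (2 * p + 1)) / sqrt (2 ^ Suc j)"

lemma block_sum_Suc: "block_sum x (Suc j) p = block_sum x j (2 * p) + block_sum x j (2 * p + 1)"
proof -
  have "{p * 2 ^ Suc j..<Suc p * 2 ^ Suc j} =
      {2 * p * 2 ^ j..<Suc (2 * p) * 2 ^ j} \<union> {Suc (2 * p) * 2 ^ j..<Suc (2 * p + 1) * 2 ^ j}"
    by (subst ivl_disj_un_two(3)) (auto simp: algebra_simps)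
  moreover have "{2 * p * 2 ^ j..<Suc (2 * p) * 2 ^ j}
      \<inter> {Suc (2 * p) * 2 ^ j..<Suc (2 * p + 1) * 2 ^ j} = ({} :: nat set)"
    by auto
  ultimately show ?thesis
    unfolding block_sum_def by (simp add: sum.union_disjoint)
qed

lemma sum_double: "(\<Sum>i<2 * k. f i) = (\<Sum>i<k. f (2 * i) + f (2 * i + 1 :: nat) :: real)"
  by (induction k) (simp_all add: algebra_simps)

text \<open>The polarised parallelogram law
  \<open>a * c + b * d = ((a + b) * (c + d) + (a - b) * (c - d)) / 2\<close> for the sums over the
  two halves.\<close>

lemma haar_mult:
  "haar x j p * haar y j p = block_sum x j (2 * p) * block_sum y j (2 * p) / 2 ^ j
     + block_sum x j (2 * p + 1) * block_sum y j (2 * p + 1) / 2 ^ j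
     - block_sum x (Suc j) p * block_sum y (Suc j) p / 2 ^ Suc j"
proof -
  have "sqrt (2 ^ Suc j) * sqrt (2 ^ Suc j) = (2 ^ Suc j :: real)"
    by simp
  then have "haar x j p * haar y j p = (block_sum x j (2 * p) - block_sum x j (2 * p + 1)) *
      (block_sum y j (2 * p) - block_sum y j (2 * p + 1)) / 2 ^ Suc j"
    unfolding haar_def by (metis times_divide_times_eq)
  moreover have "(a - b) * (c - d) / (2 * k) = a * c / k + b * d / k - (a + b) * (c + d) / (2 * k)"
    if "k > 0" for a b c d k :: real
    using that by (simp add: field_simps)
  ultimately show ?thesis
    by (simp add: block_sum_Suc)
qed

text \<open>Applying \<open>haar_mult\<close> to pairs of neighbouring blocks splits off one level
  of Haar coefficients and doubles the block length; after \<open>m\<close> levels a single block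
  remains.\<close>

lemma haar_parseval:
  "(\<Sum>i<2 ^ m. x i * y i) = block_sum x m 0 * block_sum y m 0 / 2 ^ m
     + (\<Sum>j<m. \<Sum>p<2 ^ (m - Suc j). haar x j p * haar y j p)"
proof -
  have "(\<Sum>i<2 ^ m. x i * y i) = (\<Sum>p<2 ^ (m - k). block_sum x k p * block_sum y k p / 2 ^ k)
     + (\<Sum>j<k. \<Sum>p<2 ^ (m - Suc j). haar x j p * haar y j p)" if "k \<le> m" for k
    using that
  proof (induction k)
    case 0
    then show ?case
      by (simp add: block_sum_def)
  next
    case (Suc k)
    have "2 ^ (m - k) = 2 * (2::nat) ^ (m - Suc k)"
      using Suc.prems by (simp add: Suc_diff_Suc flip: power_Suc)
    then have "(\<Sum>p<2 ^ (m - k). block_sum x k p * block_sum y k p / 2 ^ k) =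
        (\<Sum>p<2 ^ (m - Suc k). block_sum x (Suc k) p * block_sum y (Suc k) p / 2 ^ Suc k
           + haar x k p * haar y k p)"
      by (simp add: sum_double haar_mult del: power_Suc)
    then show ?case
      using Suc by (simp add: sum.distrib)
  qed
  from this[of m] show ?thesis
    by (simp add: block_sum_def)
qed

lemma abs_diff_le_variation:
  fixes x :: "nat \<Rightarrow> real"
  assumes "i \<le> k"
  shows "\<bar>x i - x k\<bar> \<le> (\<Sum>t\<in>{i<..k}. \<bar>x t - x (t - 1)\<bar>)"
  using assms
proof (induction k rule: dec_induct)
  case (step k)
  then have "{i<..Suc k} = insert (Suc k) {i<..k}"
    by auto
  then show ?case
    using step by simp
qed simp

text \<open>Each position of the left half is paired with the one \<open>2 ^ j\<close> further
  right, and the difference is at most the variation inside the block. The open interval holds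
  exactly those \<open>t\<close> for which \<open>t - 1\<close> and \<open>t\<close> both lie in the
  block.\<close>

lemma abs_haar_le_variation:
  "\<bar>haar x j p\<bar> \<le> sqrt (2 ^ Suc j) *
     (\<Sum>t\<in>{p * 2 ^ Suc j<..<Suc p * 2 ^ Suc j}. \<bar>x t - x (t - 1)\<bar>)" (is "_ \<le> _ * ?V")
proof -
  let ?a = "p * 2 ^ Suc j"
  have s: "block_sum x j (2 * p) = (\<Sum>i<2 ^ j. x (?a + i))"
    unfolding block_sum_def
    by (rule sum.reindex_bij_witness[of _ "\<lambda>i. ?a + i" "\<lambda>i. i - ?a"]) (auto simp: algebra_simps)
  have s': "block_sum x j (2 * p + 1) = (\<Sum>i<2 ^ j. x (?a + 2 ^ j + i))"
    unfolding block_sum_def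
    by (rule sum.reindex_bij_witness[of _ "\<lambda>i. ?a + 2 ^ j + i" "\<lambda>i. i - (?a + 2 ^ j)"])
      (auto simp: algebra_simps)
  have "\<bar>x (?a + i) - x (?a + 2 ^ j + i)\<bar> \<le> ?V" if "i < 2 ^ j" for i
  proof -
    have "\<bar>x (?a + i) - x (?a + 2 ^ j + i)\<bar>
        \<le> (\<Sum>t\<in>{?a + i<..?a + 2 ^ j + i}. \<bar>x t - x (t - 1)\<bar>)"
      by (rule abs_diff_le_variation) simp
    also have "\<dots> \<le> ?V"
      using that by (intro sum_mono2) auto
    finally show ?thesis .
  qed
  then have "(\<Sum>i<2 ^ j. \<bar>x (?a + i) - x (?a + 2 ^ j + i)\<bar>) \<le> (\<Sum>i<(2::nat) ^ j. ?V)"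
    by (intro sum_mono) auto
  then have "\<bar>block_sum x j (2 * p) - block_sum x j (2 * p + 1)\<bar> \<le> 2 ^ j * ?V"
    unfolding s s' sum_subtractf[symmetric] by (intro order_trans[OF sum_abs]) simp
  also have "\<dots> \<le> 2 ^ Suc j * ?V"
    by (intro mult_right_mono sum_nonneg) auto
  finally have "\<bar>haar x j p\<bar> \<le> 2 ^ Suc j * ?V / sqrt (2 ^ Suc j)"
    unfolding haar_def by (simp add: abs_divide divide_right_mono del: power_Suc)
  also have "\<dots> = sqrt (2 ^ Suc j) * ?V"
    by (simp add: real_div_sqrt flip: times_divide_eq_left del: power_Suc)
  finally show ?thesis .
qed

text \<open>The terms that are at most 1 form an initial segment, whose geometric sum is controlled
  by its last term.\<close>

lemma sum_geometric_upto_one: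
  fixes c r :: real
  assumes "0 < c" "1 < r"
  shows "(\<Sum>j<m. if c * r ^ j \<le> 1 then c * r ^ j else 0) \<le> r / (r - 1)"
proof (induction m)
  case 0
  then show ?case
    using assms by simp
next
  case (Suc m)
  show ?case
  proof (cases "c * r ^ m \<le> 1")
    case True
    have "c * r ^ j \<le> 1" if "j < Suc m" for j
      using that assms by (intro order_trans[OF mult_left_mono True] power_increasing) auto
    then have "(\<Sum>j<Suc m. if c * r ^ j \<le> 1 then c * r ^ j else 0) = c * (\<Sum>j<Suc m. r ^ j)"
      unfolding sum_distrib_left by (intro sum.cong) auto
    also have "\<dots> = (c * r ^ m * r - c) / (r - 1)"
      using assms by (subst geometric_sum) (auto simp: algebra_simps)
    also have "\<dots> \<le> r / (r - 1)"
      using assms mult_right_mono[OF True, of r] by (intro divide_right_mono) linarith+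
    finally show ?thesis .
  next
    case False
    then show ?thesis
      using Suc by simp
  qed
qed

text \<open>Shifting the index replaces \<open>c\<close> by \<open>2 * c\<close>. The factor
  \<open>min 1 (1 / c)\<close> sharpens the bound 2 so that the induction hypothesis leaves room for
  the first term.\<close>

lemma sum_geometric_from_one:
  fixes c :: real
  assumes "0 < c"
  shows "(\<Sum>j<m. if 1 \<le> c * 2 ^ j then 1 / (c * 2 ^ j) else 0) \<le> 2 * min 1 (1 / c)"
  using assms
proof (induction m arbitrary: c)
  case (Suc m)
  have "(\<Sum>j<Suc m. if 1 \<le> c * 2 ^ j then 1 / (c * 2 ^ j) else 0) =
      (if 1 \<le> c then 1 / c else 0)
      + (\<Sum>j<m. if 1 \<le> (2 * c) * 2 ^ j then 1 / ((2 * c) * 2 ^ j) else 0)"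
    by (subst sum.lessThan_Suc_shift) (simp add: mult.assoc mult.left_commute cong: if_cong)
  also have "\<dots> \<le> (if 1 \<le> c then 1 / c else 0) + 2 * min 1 (1 / (2 * c))"
    using Suc.IH[of "2 * c"] Suc.prems by simp
  also have "\<dots> \<le> 2 * min 1 (1 / c)"
    using Suc.prems by (auto simp: min_def field_simps)
  finally show ?case .
qed simp

subsection \<open>Moments of sub-Gaussian sums\<close>

text \<open>A single term of the exponential series.\<close>

lemma power_le_fact_exp:
  fixes x :: real
  assumes "0 \<le> x"
  shows "x ^ n \<le> fact n * exp x"
proof -
  have "(\<Sum>k\<in>{n}. x ^ k /\<^sub>R fact k) \<le> (\<Sum>k. x ^ k /\<^sub>R fact k)"
    using assms by (intro sum_le_suminf sums_summable[OF exp_converges]) auto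
  then have "x ^ n / fact n \<le> exp x"
    using exp_converges[of x] by (simp add: sums_iff divide_inverse mult.commute)
  then show ?thesis
    by (simp add: field_simps)
qed

text \<open>Second-order Taylor expansion with the Lagrange remainder.\<close>

lemma exp_le_quadratic:
  fixes x :: real
  shows "exp x \<le> 1 + x + x\<^sup>2 * exp \<bar>x\<bar>"
proof -
  obtain t where t: "\<bar>t\<bar> \<le> \<bar>x\<bar>" "exp x = (\<Sum>m<2. x ^ m / fact m) + exp t / fact 2 * x ^ 2"
    using Maclaurin_exp_le[of x 2] by blast
  have "exp t / 2 * x\<^sup>2 \<le> exp \<bar>x\<bar> * x\<^sup>2"
  proof (rule mult_right_mono)
    have "exp t \<le> exp \<bar>x\<bar>"
      using t(1) by simp
    then show "exp t / 2 \<le> exp \<bar>x\<bar>"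
      using exp_gt_zero[of "\<bar>x\<bar>"] by linarith
  qed simp
  then show ?thesis
    using t(2) by (simp add: numeral_2_eq_2 mult.commute)
qed

lemma summable_exp_linear_minus_square:
  fixes \<sigma> :: real
  assumes "\<sigma> > 0"
  shows "summable (\<lambda>k. exp (2 * (real k + 1) - (real k)\<^sup>2 / (2 * \<sigma>\<^sup>2)))"
proof (rule summable_comparison_test')
  show "summable (\<lambda>k. exp (-1 :: real) ^ k)"
    by (simp add: summable_geometric)
  fix k :: nat
  \<comment> \<open>From here on the quadratic part is at least \<open>5 * k\<close> and
    \<open>k\<close> is at least 1, which leaves an exponent of at most \<open>- k\<close>.\<close>
  assume k: "nat \<lceil>10 * \<sigma>\<^sup>2 + 1\<rceil> \<le> k"
  then have "10 * \<sigma>\<^sup>2 \<le> real k" "1 \<le> real k"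
    using assms zero_le_power2[of \<sigma>] by linarith+
  then have "10 * \<sigma>\<^sup>2 * real k \<le> real k * real k"
    by (intro mult_right_mono) auto
  then have "5 * real k \<le> (real k)\<^sup>2 / (2 * \<sigma>\<^sup>2)"
    using assms by (simp add: field_simps power2_eq_square)
  moreover have "2 * (x + 1) - D \<le> - x" if "5 * x \<le> D" "1 \<le> x" for x D :: real
    using that by argo
  ultimately have "2 * (real k + 1) - (real k)\<^sup>2 / (2 * \<sigma>\<^sup>2) \<le> - real k"
    using \<open>1 \<le> real k\<close> by blast
  then have "exp (2 * (real k + 1) - (real k)\<^sup>2 / (2 * \<sigma>\<^sup>2)) \<le> exp (- real k)"
    by (simp only: exp_le_cancel_iff)
  then show "norm (exp (2 * (real k + 1) - (real k)\<^sup>2 / (2 * \<sigma>\<^sup>2))) \<le> exp (-1) ^ k"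
    using exp_of_nat_mult[of k "-1::real"] by (simp only: norm_exp real_norm_def abs_exp_cancel mult_minus1_right)
qed

text \<open>Bounds the mean of \<open>exp (2 * \<bar>X\<bar>)\<close> slice by slice: on
  \<open>k < \<bar>X\<bar> \<le> k + 1\<close> the value is at most \<open>exp (2 * (k + 1))\<close>
  and the tail bound at \<open>k\<close> applies. The leading 1 covers \<open>X = 0\<close>.\<close>

definition exp_moment_bound :: "real \<Rightarrow> real \<Rightarrow> real" where
  "exp_moment_bound M \<sigma> = 1 + M * (\<Sum>k. exp (2 * (real k + 1) - (real k)\<^sup>2 / (2 * \<sigma>\<^sup>2)))"

lemma exp_moment_bound_ge_1:
  assumes "M > 0" "\<sigma> > 0"
  shows "exp_moment_bound M \<sigma> \<ge> 1"
  unfolding exp_moment_bound_def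
  using assms summable_exp_linear_minus_square[OF assms(2)] by (simp add: suminf_nonneg)

text \<open>The factor 2 in the exponent serves \<open>mgf_sub_gaussian\<close>, where one factor
  \<open>exp \<bar>x\<bar>\<close> pays for the square of \<open>x\<close> and one for the Taylor
  remainder.\<close>

lemma (in prob_space) exp_moment_sub_gaussian:
  fixes X :: "'a \<Rightarrow> real"
  assumes pos: "B > 0" "\<sigma> > 0"
    and X[measurable]: "X \<in> borel_measurable M"
    and tail: "\<And>u. u \<ge> 0 \<Longrightarrow> prob {\<omega> \<in> space M. \<bar>X \<omega>\<bar> > u} \<le> B * exp (- u\<^sup>2 / (2 * \<sigma>\<^sup>2))"
  shows "integrable M (\<lambda>\<omega>. exp (2 * \<bar>X \<omega>\<bar>))"
    and "expectation (\<lambda>\<omega>. exp (2 * \<bar>X \<omega>\<bar>)) \<le> exp_moment_bound B \<sigma>"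
proof -
  define e where "e k = exp (2 * (real k + 1))" for k
  define f where "f k = exp (2 * (real k + 1) - (real k)\<^sup>2 / (2 * \<sigma>\<^sup>2))" for k
  have e_nonneg: "0 \<le> e k" for k
    by (simp add: e_def)
  have f: "summable f" "\<And>k. 0 \<le> f k"
    using summable_exp_linear_minus_square[OF pos(2)] by (simp_all add: f_def[abs_def])
  have le_suminf: "g k \<le> suminf g" for g :: "nat \<Rightarrow> ennreal" and k
    using sum_le_suminf[of g "{k}"] by simp
  have pw: "ennreal (exp (2 * \<bar>x\<bar>))
      \<le> 1 + (\<Sum>k. ennreal (e k) * indicator {y. \<bar>y\<bar> > real k} x)" for x :: real
  proof (cases "x = 0")
    case False
    define k where "k = nat (\<lceil>\<bar>x\<bar>\<rceil> - 1)"
    have k: "real k < \<bar>x\<bar>" "\<bar>x\<bar> \<le> real k + 1"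
      using False unfolding k_def by linarith+
    have "ennreal (exp (2 * \<bar>x\<bar>)) \<le> ennreal (e k) * indicator {y. \<bar>y\<bar> > real k} x"
      using k by (auto simp: e_def)
    also have "\<dots> \<le> (\<Sum>k. ennreal (e k) * indicator {y. \<bar>y\<bar> > real k} x)"
      by (rule le_suminf)
    finally show ?thesis
      by (simp add: add_increasing)
  qed simp
  have tail_le: "ennreal (e k) * emeasure M {\<omega> \<in> space M. \<bar>X \<omega>\<bar> > real k} \<le> ennreal (B * f k)" for k
  proof -
    have "e k * prob {\<omega> \<in> space M. \<bar>X \<omega>\<bar> > real k}
        \<le> e k * (B * exp (- (real k)\<^sup>2 / (2 * \<sigma>\<^sup>2)))"
      by (intro mult_left_mono tail) (auto simp: e_def)
    also have "\<dots> = B * f k"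
      by (simp add: e_def f_def exp_diff exp_minus field_simps)
    finally show ?thesis
      by (simp add: emeasure_eq_measure e_nonneg ennreal_leI flip: ennreal_mult)
  qed
  have "(\<integral>\<^sup>+\<omega>. ennreal (exp (2 * \<bar>X \<omega>\<bar>)) \<partial>M)
      \<le> (\<integral>\<^sup>+\<omega>. 1 + (\<Sum>k. ennreal (e k) * indicator {y. \<bar>y\<bar> > real k} (X \<omega>)) \<partial>M)"
    by (intro nn_integral_mono pw)
  also have "\<dots> = 1 + (\<Sum>k. \<integral>\<^sup>+\<omega>. ennreal (e k) * indicator {y. \<bar>y\<bar> > real k} (X \<omega>) \<partial>M)"
    by (subst nn_integral_add) (auto simp: nn_integral_suminf emeasure_space_1)
  also have "(\<lambda>k. \<integral>\<^sup>+\<omega>. ennreal (e k) * indicator {y. \<bar>y\<bar> > real k} (X \<omega>) \<partial>M) =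
      (\<lambda>k. ennreal (e k) * emeasure M {\<omega> \<in> space M. \<bar>X \<omega>\<bar> > real k})"
  proof
    fix k
    have "(\<integral>\<^sup>+\<omega>. ennreal (e k) * indicator {y. \<bar>y\<bar> > real k} (X \<omega>) \<partial>M) =
        (\<integral>\<^sup>+\<omega>. ennreal (e k) * indicator {\<omega> \<in> space M. \<bar>X \<omega>\<bar> > real k} \<omega> \<partial>M)"
      by (intro nn_integral_cong) (auto simp: indicator_def)
    then show "(\<integral>\<^sup>+\<omega>. ennreal (e k) * indicator {y. \<bar>y\<bar> > real k} (X \<omega>) \<partial>M) =
        ennreal (e k) * emeasure M {\<omega> \<in> space M. \<bar>X \<omega>\<bar> > real k}"
      by (simp add: nn_integral_cmult_indicator)
  qed
  also have "1 + (\<Sum>k. ennreal (e k) * emeasure M {\<omega> \<in> space M. \<bar>X \<omega>\<bar> > real k})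
      \<le> 1 + (\<Sum>k. ennreal (B * f k))"
    by (intro add_left_mono suminf_le tail_le) auto
  also have "(\<Sum>k. ennreal (B * f k)) = ennreal (\<Sum>k. B * f k)"
    using f pos by (intro suminf_ennreal2) (auto intro: summable_mult)
  also have "(\<Sum>k. B * f k) = B * (\<Sum>k. f k)"
    using f by (simp add: suminf_mult)
  also have "1 + ennreal (B * (\<Sum>k. f k)) = ennreal (exp_moment_bound B \<sigma>)"
    using f pos unfolding exp_moment_bound_def f_def[abs_def, symmetric]
    by (subst ennreal_plus) (auto intro!: mult_nonneg_nonneg suminf_nonneg)
  finally have nn: "(\<integral>\<^sup>+\<omega>. ennreal (exp (2 * \<bar>X \<omega>\<bar>)) \<partial>M) \<le> ennreal (exp_moment_bound B \<sigma>)" .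
  show int: "integrable M (\<lambda>\<omega>. exp (2 * \<bar>X \<omega>\<bar>))"
    by (rule integrableI_nonneg) (use nn in \<open>auto intro: le_less_trans\<close>)
  show "expectation (\<lambda>\<omega>. exp (2 * \<bar>X \<omega>\<bar>)) \<le> exp_moment_bound B \<sigma>"
    using nn exp_moment_bound_ge_1[OF pos] nn_integral_eq_integral[OF int] by simp
qed

text \<open>The linear term has mean 0, so only the quadratic remainder contributes;
  \<open>1 + u \<le> exp u\<close> then gives the exponential form.\<close>

lemma (in prob_space) mgf_sub_gaussian:
  fixes X :: "'a \<Rightarrow> real"
  assumes pos: "B > 0" "\<sigma> > 0"
    and X: "integrable M X" "expectation X = 0"
    and tail: "\<And>u. u \<ge> 0 \<Longrightarrow> prob {\<omega> \<in> space M. \<bar>X \<omega>\<bar> > u} \<le> B * exp (- u\<^sup>2 / (2 * \<sigma>\<^sup>2))"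
    and t: "\<bar>t\<bar> \<le> 1"
  shows "integrable M (\<lambda>\<omega>. exp (t * X \<omega>))"
    and "expectation (\<lambda>\<omega>. exp (t * X \<omega>)) \<le> exp (2 * exp_moment_bound B \<sigma> * t\<^sup>2)"
proof -
  have [measurable]: "X \<in> borel_measurable M"
    using X by auto
  note e = exp_moment_sub_gaussian[OF pos _ tail]
  have tx: "\<bar>t * x\<bar> \<le> \<bar>x\<bar>" for x
    using t by (simp add: abs_mult mult_left_le_one_le)
  show int: "integrable M (\<lambda>\<omega>. exp (t * X \<omega>))"
  proof (rule Bochner_Integration.integrable_bound[OF e(1)])
    show "AE \<omega> in M. norm (exp (t * X \<omega>)) \<le> norm (exp (2 * \<bar>X \<omega>\<bar>))"
    proof (intro AE_I2)
      fix \<omega>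
      show "norm (exp (t * X \<omega>)) \<le> norm (exp (2 * \<bar>X \<omega>\<bar>))"
        using tx[of "X \<omega>"] by simp
    qed
  qed auto
  have "exp (t * x) \<le> 1 + t * x + 2 * t\<^sup>2 * exp (2 * \<bar>x\<bar>)" for x
  proof -
    have "exp \<bar>t * x\<bar> \<le> exp \<bar>x\<bar>"
      using tx by simp
    then have "(t * x)\<^sup>2 * exp \<bar>t * x\<bar> \<le> t\<^sup>2 * (\<bar>x\<bar> ^ 2 * exp \<bar>x\<bar>)"
      by (simp add: power_mult_distrib mult.assoc mult_left_mono)
    also have "\<dots> \<le> t\<^sup>2 * (fact 2 * exp \<bar>x\<bar> * exp \<bar>x\<bar>)"
      by (intro mult_left_mono mult_right_mono power_le_fact_exp) auto
    also have "\<dots> = 2 * t\<^sup>2 * exp (2 * \<bar>x\<bar>)"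
      by (simp add: mult_exp_exp)
    finally show ?thesis
      using exp_le_quadratic[of "t * x"] by linarith
  qed
  then have "expectation (\<lambda>\<omega>. exp (t * X \<omega>))
      \<le> expectation (\<lambda>\<omega>. 1 + t * X \<omega> + 2 * t\<^sup>2 * exp (2 * \<bar>X \<omega>\<bar>))"
    using int X e(1) by (intro integral_mono) auto
  also have "\<dots> = 1 + 2 * t\<^sup>2 * expectation (\<lambda>\<omega>. exp (2 * \<bar>X \<omega>\<bar>))"
    using X e(1) by (simp add: prob_space)
  also have "\<dots> \<le> 1 + 2 * t\<^sup>2 * exp_moment_bound B \<sigma>"
    using e(2) by (intro add_left_mono mult_left_mono) auto
  also have "\<dots> \<le> exp (2 * exp_moment_bound B \<sigma> * t\<^sup>2)"
    using exp_ge_add_one_self[of "2 * exp_moment_bound B \<sigma> * t\<^sup>2"] by (simp add: mult_ac)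
  finally show "expectation (\<lambda>\<omega>. exp (t * X \<omega>)) \<le> exp (2 * exp_moment_bound B \<sigma> * t\<^sup>2)" .
qed

text \<open>Serves to pass from the node numbering of the noise to the order of the chain. An
  intersection over \<open>J\<close> is rewritten as one over the image of \<open>J\<close>, where
  \<open>f\<close> can be inverted.\<close>

lemma (in prob_space) indep_vars_reindex:
  assumes ind: "indep_vars (\<lambda>_. N) Y (f ` I)" and f: "inj_on f I"
  shows "indep_vars (\<lambda>_. N) (\<lambda>i. Y (f i)) I"
proof -
  let ?F = "\<lambda>k. {Y k -` B \<inter> space M | B. B \<in> sets N}"
  have Y: "\<And>k. k \<in> f ` I \<Longrightarrow> random_variable N (Y k)" "indep_sets ?F (f ` I)"
    using ind by (auto simp: indep_vars_def2)
  have "indep_sets (\<lambda>i. ?F (f i)) I"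
    unfolding indep_sets_def
  proof (intro conjI ballI allI impI)
    fix i
    assume "i \<in> I"
    then show "?F (f i) \<subseteq> events"
      using Y(1)[of "f i"] measurable_sets by blast
  next
    fix J A
    assume J: "J \<subseteq> I" "J \<noteq> {}" "finite J" and A: "A \<in> Pi J (\<lambda>i. ?F (f i))"
    define g where "g = the_inv_into I f"
    have g: "g (f j) = j" if "j \<in> J" for j
      using that J f by (auto simp: g_def the_inv_into_f_f)
    have "prob (\<Inter>k\<in>f ` J. A (g k)) = (\<Prod>k\<in>f ` J. prob (A (g k)))"
    proof (rule indep_setsD[OF Y(2)])
      show "\<forall>k\<in>f ` J. A (g k) \<in> ?F k"
        using A g by auto
    qed (use J in auto)
    moreover have "(\<Inter>k\<in>f ` J. A (g k)) = (\<Inter>j\<in>J. A j)"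
      using g by auto
    moreover have "(\<Prod>k\<in>f ` J. prob (A (g k))) = (\<Prod>j\<in>J. prob (A j))"
      using g J f by (subst prod.reindex) (auto intro: inj_on_subset)
    ultimately show "prob (\<Inter>j\<in>J. A j) = (\<Prod>j\<in>J. prob (A j))"
      by simp
  qed
  then show ?thesis
    using Y(1) by (auto simp: indep_vars_def2)
qed

text \<open>Norm at most 1 keeps every coefficient in the range of the coordinatewise bounds; by
  independence the exponents add up to \<open>C\<close> times the squared norm.\<close>

lemma (in prob_space) mgf_linear_combination:
  fixes X :: "'i \<Rightarrow> 'a \<Rightarrow> real"
  assumes I: "finite I" "indep_vars (\<lambda>_. borel) X I"
    and mgf: "\<And>i t. i \<in> I \<Longrightarrow> \<bar>t\<bar> \<le> 1 \<Longrightarrow> integrable M (\<lambda>\<omega>. exp (t * X i \<omega>))"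
      "\<And>i t. i \<in> I \<Longrightarrow> \<bar>t\<bar> \<le> 1 \<Longrightarrow> expectation (\<lambda>\<omega>. exp (t * X i \<omega>)) \<le> exp (C * t\<^sup>2)"
    and "C \<ge> 0" and a: "(\<Sum>i\<in>I. (a i)\<^sup>2) \<le> 1"
  shows "integrable M (\<lambda>\<omega>. exp (\<Sum>i\<in>I. a i * X i \<omega>))"
    and "expectation (\<lambda>\<omega>. exp (\<Sum>i\<in>I. a i * X i \<omega>)) \<le> exp C"
proof -
  have a1: "\<bar>a i\<bar> \<le> 1" if "i \<in> I" for i
  proof -
    have "(a i)\<^sup>2 \<le> (\<Sum>i\<in>I. (a i)\<^sup>2)"
      using that I by (intro member_le_sum) auto
    from order_trans[OF this a] show ?thesis
      by (simp add: abs_square_le_1)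
  qed
  have ind: "indep_vars (\<lambda>_. borel) (\<lambda>i \<omega>. exp (a i * X i \<omega>)) I"
    by (rule indep_vars_compose2[OF I(2)]) auto
  note int = mgf(1)[OF _ a1]
  have eq: "(\<lambda>\<omega>. exp (\<Sum>i\<in>I. a i * X i \<omega>)) = (\<lambda>\<omega>. \<Prod>i\<in>I. exp (a i * X i \<omega>))"
    using I by (simp add: exp_sum)
  show "integrable M (\<lambda>\<omega>. exp (\<Sum>i\<in>I. a i * X i \<omega>))"
    unfolding eq by (rule indep_vars_integrable[OF I(1) ind]) (use int in auto)
  have "expectation (\<lambda>\<omega>. exp (\<Sum>i\<in>I. a i * X i \<omega>))
      = (\<Prod>i\<in>I. expectation (\<lambda>\<omega>. exp (a i * X i \<omega>)))"
    unfolding eq by (rule indep_vars_lebesgue_integral[OF I(1) ind]) (use int in auto)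
  also have "\<dots> \<le> (\<Prod>i\<in>I. exp (C * (a i)\<^sup>2))"
    by (intro prod_mono conjI mgf(2) a1 integral_nonneg_AE) auto
  also have "\<dots> = exp (C * (\<Sum>i\<in>I. (a i)\<^sup>2))"
    using I by (simp add: exp_sum sum_distrib_left)
  also have "\<dots> \<le> exp C"
    using a \<open>C \<ge> 0\<close> by (simp add: mult_left_le)
  finally show "expectation (\<lambda>\<omega>. exp (\<Sum>i\<in>I. a i * X i \<omega>)) \<le> exp C" .
qed

text \<open>What soft-thresholding at \<open>\<tau>\<close> leaves of the absolute value.\<close>

definition excess :: "real \<Rightarrow> real \<Rightarrow> real" where
  "excess \<tau> z = max 0 (\<bar>z\<bar> - \<tau>)"

lemma excess_measurable[measurable]: "excess \<tau> \<in> borel_measurable borel"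
  unfolding excess_def[abs_def] by measurable

text \<open>The excess is nonzero only for \<open>\<bar>z\<bar> > \<tau>\<close>, where
  \<open>z\<^sup>2 \<le> z ^ 10 / \<tau> ^ 8\<close>, and the tenth power is at most
  \<open>fact 10 * exp \<bar>z\<bar>\<close>. The thresholds used later are fourth roots of a scale
  ratio, so the eighth power yields quadratic decay in that ratio.\<close>

lemma (in prob_space) excess_moment:
  assumes Z[measurable]: "Z \<in> borel_measurable M"
    and mgf: "integrable M (\<lambda>\<omega>. exp (Z \<omega>))" "integrable M (\<lambda>\<omega>. exp (- Z \<omega>))"
      "expectation (\<lambda>\<omega>. exp (Z \<omega>)) \<le> K" "expectation (\<lambda>\<omega>. exp (- Z \<omega>)) \<le> K"
    and \<tau>: "\<tau> \<ge> 0"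
  shows "integrable M (\<lambda>\<omega>. (excess \<tau> (Z \<omega>))\<^sup>2)"
    and "expectation (\<lambda>\<omega>. (excess \<tau> (Z \<omega>))\<^sup>2) \<le> 2 * fact 10 * K"
    and "\<tau> > 0 \<Longrightarrow> expectation (\<lambda>\<omega>. (excess \<tau> (Z \<omega>))\<^sup>2) \<le> 2 * fact 10 * K / \<tau> ^ 8"
proof -
  let ?c = "\<lambda>\<omega>. exp (Z \<omega>) + exp (- Z \<omega>)"
  have int: "integrable M ?c" and le: "expectation ?c \<le> 2 * K"
    using mgf by auto
  have exp_abs: "exp \<bar>z\<bar> \<le> exp z + exp (- z)" for z :: real
    by (simp add: abs_if)
  have sq: "(excess \<tau> z)\<^sup>2 \<le> \<bar>z\<bar>\<^sup>2" for z
    using \<tau> by (intro power_mono) (auto simp: excess_def)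
  have b2: "(excess \<tau> z)\<^sup>2 \<le> fact 10 * (exp z + exp (- z))" for z
  proof -
    have "(excess \<tau> z)\<^sup>2 \<le> fact 2 * exp \<bar>z\<bar>"
      using sq power_le_fact_exp[of "\<bar>z\<bar>" 2] by (meson abs_ge_zero order_trans)
    also have "\<dots> \<le> fact 10 * (exp z + exp (- z))"
      by (intro mult_mono exp_abs fact_mono) auto
    finally show ?thesis .
  qed
  have b10: "(excess \<tau> z)\<^sup>2 \<le> fact 10 / \<tau> ^ 8 * (exp z + exp (- z))" if "\<tau> > 0" for z
  proof -
    have "(excess \<tau> z)\<^sup>2 \<le> \<bar>z\<bar> ^ 10 / \<tau> ^ 8"
    proof (cases "\<bar>z\<bar> \<le> \<tau>")
      case False
      then have "\<bar>z\<bar>\<^sup>2 * \<tau> ^ 8 \<le> \<bar>z\<bar>\<^sup>2 * \<bar>z\<bar> ^ 8"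
        using \<tau> by (intro mult_left_mono power_mono) auto
      then have "\<bar>z\<bar>\<^sup>2 \<le> \<bar>z\<bar> ^ 10 / \<tau> ^ 8"
        using that by (simp add: pos_le_divide_eq flip: power_add)
      then show ?thesis
        using sq order_trans by blast
    qed (use that in \<open>simp add: excess_def\<close>)
    also have "\<dots> \<le> fact 10 * (exp z + exp (- z)) / \<tau> ^ 8"
      using that power_le_fact_exp[of "\<bar>z\<bar>" 10] exp_abs[of z]
      by (intro divide_right_mono) (auto intro: order_trans mult_left_mono)
    finally show ?thesis
      by simp
  qed
  show int2: "integrable M (\<lambda>\<omega>. (excess \<tau> (Z \<omega>))\<^sup>2)"
    by (rule Bochner_Integration.integrable_bound[OF Bochner_Integration.integrable_mult_right[OF int, of "fact 10"]])
      (use b2 in \<open>auto simp: add_pos_pos intro!: AE_I2 order_trans[OF b2]\<close>)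
  have "expectation (\<lambda>\<omega>. (excess \<tau> (Z \<omega>))\<^sup>2) \<le> expectation (\<lambda>\<omega>. fact 10 * ?c \<omega>)"
    by (intro integral_mono int2 Bochner_Integration.integrable_mult_right int b2)
  also have "\<dots> \<le> fact 10 * (2 * K)"
    using le by (subst Bochner_Integration.integral_mult_right[OF int]) (auto intro: mult_left_mono)
  finally show "expectation (\<lambda>\<omega>. (excess \<tau> (Z \<omega>))\<^sup>2) \<le> 2 * fact 10 * K"
    by simp
  assume "\<tau> > 0"
  have "expectation (\<lambda>\<omega>. (excess \<tau> (Z \<omega>))\<^sup>2) \<le> expectation (\<lambda>\<omega>. fact 10 / \<tau> ^ 8 * ?c \<omega>)"
    by (intro integral_mono int2 Bochner_Integration.integrable_mult_right int b10 \<open>\<tau> > 0\<close>)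
  also have "\<dots> \<le> fact 10 / \<tau> ^ 8 * (2 * K)"
    using le \<open>\<tau> > 0\<close> by (subst Bochner_Integration.integral_mult_right[OF int]) (auto intro!: divide_right_mono mult_left_mono)
  finally show "expectation (\<lambda>\<omega>. (excess \<tau> (Z \<omega>))\<^sup>2) \<le> 2 * fact 10 * K / \<tau> ^ 8"
    by (simp add: mult_ac)
qed

subsection \<open>Dual vector and bias\<close>

lemma sum_square_orthogonal:
  fixes f :: "'a \<Rightarrow> real"
  assumes "finite A" "\<And>i j. i \<in> A \<Longrightarrow> j \<in> A \<Longrightarrow> i \<noteq> j \<Longrightarrow> f i * f j = 0"
  shows "(\<Sum>i\<in>A. f i)\<^sup>2 = (\<Sum>i\<in>A. (f i)\<^sup>2)"
proof -
  have "(\<Sum>j\<in>A. f i * f j) = (f i)\<^sup>2" if "i \<in> A" for i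
  proof -
    have "(\<Sum>j\<in>A. f i * f j) = (\<Sum>j\<in>A. if j = i then (f i)\<^sup>2 else 0)"
      using that assms(2) by (intro sum.cong) (auto simp: power2_eq_square)
    then show ?thesis
      using that assms(1) by simp
  qed
  then show ?thesis
    by (simp add: power2_eq_square sum_product)
qed

text \<open>Moves the differences from the error to the dual vector; the boundary terms vanish there
  because the dual vector is 0 at \<open>0\<close> and \<open>n\<close>.\<close>

lemma abel_summation_diff:
  fixes q x :: "nat \<Rightarrow> real"
  assumes "1 \<le> n"
  shows "(\<Sum>t=1..<n. q t * (x t - x (t - 1))) =
    (\<Sum>i<n. x i * (q i - q (Suc i))) + q n * x (n - 1) - q 0 * x 0"
  using assms
proof (induction n rule: nat_induct_at_least)
  case (Suc n)
  then show ?case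
    by (simp add: sum.atLeastLessThan_Suc algebra_simps)
qed (simp add: algebra_simps)

text \<open>Multiplication by the conjugate sum of roots, which is at least
  \<open>sqrt (Suc d)\<close>. With this the square root part of \<open>ramp\<close> costs only a
  harmonic sum.\<close>

lemma sqrt_Suc_diff_square_le: "(sqrt (real (Suc d)) - sqrt (real d))\<^sup>2 \<le> 1 / real (Suc d)"
proof -
  have "(sqrt (real (Suc d)) - sqrt (real d)) * sqrt (real (Suc d))
      \<le> (sqrt (real (Suc d)) - sqrt (real d)) * (sqrt (real (Suc d)) + sqrt (real d))"
    by (intro mult_left_mono) auto
  also have "\<dots> = 1"
    by (simp add: algebra_simps)
  finally have "sqrt (real (Suc d)) - sqrt (real d) \<le> 1 / sqrt (real (Suc d))"
    by (simp add: field_simps)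
  then have "(sqrt (real (Suc d)) - sqrt (real d))\<^sup>2 \<le> (1 / sqrt (real (Suc d)))\<^sup>2"
    by (intro power_mono) auto
  then show ?thesis
    by (simp add: power_divide)
qed

text \<open>The distance \<open>\<bar>i - j\<bar>\<close> in natural numbers: one of the two
  truncated differences is always 0.\<close>

definition gap :: "nat \<Rightarrow> nat \<Rightarrow> nat" where
  "gap i j = (i - j) + (j - i)"

text \<open>An index \<open>t\<close> stands for the edge between the 0-based chain positions
  \<open>t - 1\<close> and \<open>t\<close>. The ends \<open>0\<close> and \<open>n\<close> take
  part in \<open>sep\<close>, so the outermost constancy blocks are at least \<open>W\<close> long
  as well.\<close>

locale spaced_jumps =
  fixes n W :: nat and S :: "nat set" and lam :: real
  assumes S: "S \<subseteq> {1..<n}"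
    and sep: "\<And>i j. i \<in> insert 0 (insert n S) \<Longrightarrow> j \<in> insert 0 (insert n S) \<Longrightarrow> i < j \<Longrightarrow> W \<le> j - i"
    and n: "1 \<le> n" and W: "1 \<le> W" and lam: "0 < lam"
begin

definition T :: "nat set" where
  "T = insert 0 (insert n S)"

lemma finite_S[simp]: "finite S" and finite_T[simp]: "finite T"
  using S finite_subset by (auto simp: T_def)

text \<open>
  The linear part makes the ramps of neighbouring jumps disjoint. The square root part keeps
  \<open>lam * (1 - ramp d)\<close> above \<open>sqrt d\<close>, the size of a random walk after \<open>d\<close> steps, wherever the ramp is
  positive; its increments have square sum of order \<open>ln n / lam\<^sup>2\<close> only.
\<close>

definition ramp :: "nat \<Rightarrow> real" where
  "ramp d = max 0 (1 - 2 * real d / real W - sqrt (real d) / lam)"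

definition dual :: "(nat \<Rightarrow> real) \<Rightarrow> nat \<Rightarrow> real" where
  "dual \<sigma> t = (\<Sum>j\<in>S. \<sigma> j * ramp (gap t j))"

lemma ramp_0 [simp]: "ramp 0 = 1" and ramp_nonneg: "0 \<le> ramp d"
  by (auto simp: ramp_def)

lemma ramp_eq_0:
  assumes "W \<le> 2 * d"
  shows "ramp d = 0"
proof -
  have "real W \<le> 2 * real d"
    using assms by linarith
  then have "1 \<le> 2 * real d / real W"
    using W by (simp add: field_simps)
  moreover have "0 \<le> sqrt (real d) / lam"
    using lam by simp
  ultimately show ?thesis
    unfolding ramp_def by linarith
qed

lemma sep_S: "i \<in> S \<Longrightarrow> j \<in> S \<Longrightarrow> i < j \<Longrightarrow> i + W \<le> j"
  using sep[of i j] by auto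

text \<open>A nonzero ramp means a distance below \<open>W / 2\<close>; the jumps are
  \<open>W\<close> apart, so by the triangle inequality every other jump is at least
  \<open>W / 2\<close> away.\<close>

lemma ramp_disjoint:
  assumes "j \<in> S" "k \<in> S" "j \<noteq> k" "ramp (gap t j) \<noteq> 0"
  shows "ramp (gap t k) = 0"
proof (rule ramp_eq_0)
  have "2 * gap t j < W"
    using assms(4) ramp_eq_0 by (meson not_le)
  moreover have "W \<le> gap j k"
    using sep_S[of j k] sep_S[of k j] assms by (cases "j < k") (auto simp: gap_def)
  moreover have "gap j k \<le> gap t j + gap t k"
    unfolding gap_def by linarith
  ultimately show "W \<le> 2 * gap t k"
    by linarith
qed

lemma dual_eq:
  assumes "j \<in> S" "ramp (gap t j) \<noteq> 0"
  shows "dual \<sigma> t = \<sigma> j * ramp (gap t j)"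
proof -
  have "dual \<sigma> t = (\<Sum>k\<in>S. if k = j then \<sigma> j * ramp (gap t j) else 0)"
    unfolding dual_def using assms ramp_disjoint[OF assms(1) _ _ assms(2)]
    by (intro sum.cong) auto
  then show ?thesis
    using assms by simp
qed

lemma dual_jump: "j \<in> S \<Longrightarrow> dual \<sigma> j = \<sigma> j"
  using dual_eq[of j j] by (simp add: gap_def)

text \<open>Both ends are at distance at least \<open>W\<close> from every jump, beyond the reach of
  the ramps.\<close>

lemma dual_ends [simp]: "dual \<sigma> 0 = 0" "dual \<sigma> n = 0"
proof -
  have "ramp (gap 0 j) = 0" "ramp (gap n j) = 0" if "j \<in> S" for j
    using that S sep[of 0 j] sep[of j n] by (auto intro!: ramp_eq_0 simp: gap_def)
  then show "dual \<sigma> 0 = 0" "dual \<sigma> n = 0"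
    by (simp_all add: dual_def)
qed

text \<open>Its square root is the amount of noise that the edge \<open>t\<close> can absorb; the
  cap reflects that the weight of an edge is at most \<open>lam\<close>.\<close>

definition edge_scale :: "nat \<Rightarrow> real" where
  "edge_scale t = Min (insert (lam\<^sup>2) ((\<lambda>s. real (gap t s)) ` T))"

lemma edge_scale_le: "edge_scale t \<le> lam\<^sup>2" "s \<in> T \<Longrightarrow> edge_scale t \<le> real (gap t s)"
  unfolding edge_scale_def by (auto intro!: Min_le)

lemma edge_scale_nonneg: "0 \<le> edge_scale t"
  unfolding edge_scale_def by (auto simp: Min_ge_iff)

lemma edge_scale_T: "t \<in> T \<Longrightarrow> edge_scale t = 0"
  using edge_scale_le(2)[of t t] edge_scale_nonneg[of t] by (simp add: gap_def)

text \<open>Near a jump a single ramp is active and its square root part gives the bound; elsewhere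
  the dual vector is 0 and the cap \<open>lam\<^sup>2\<close> suffices.\<close>

lemma sqrt_edge_scale_le:
  assumes "\<And>j. \<bar>\<sigma> j\<bar> \<le> 1"
  shows "sqrt (edge_scale t) \<le> lam * (1 - \<bar>dual \<sigma> t\<bar>)"
proof (cases "\<exists>j\<in>S. ramp (gap t j) \<noteq> 0")
  case True
  then obtain j where j: "j \<in> S" "ramp (gap t j) \<noteq> 0"
    by blast
  have "\<bar>dual \<sigma> t\<bar> \<le> ramp (gap t j)"
    using j assms[of j] ramp_nonneg[of "gap t j"]
    by (simp add: dual_eq abs_mult mult_left_le_one_le)
  moreover have "ramp (gap t j) \<le> 1 - sqrt (real (gap t j)) / lam"
    using j(2) by (auto simp: ramp_def max_def split: if_splits)
  ultimately have "sqrt (real (gap t j)) / lam \<le> 1 - \<bar>dual \<sigma> t\<bar>"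
    by linarith
  then have "sqrt (real (gap t j)) \<le> lam * (1 - \<bar>dual \<sigma> t\<bar>)"
    using lam by (simp add: field_simps)
  moreover have "sqrt (edge_scale t) \<le> sqrt (real (gap t j))"
    using edge_scale_le(2)[of j t] j by (simp add: T_def)
  ultimately show ?thesis
    by linarith
next
  case False
  then have "dual \<sigma> t = 0"
    by (simp add: dual_def)
  then show ?thesis
    using real_sqrt_le_mono[OF edge_scale_le(1)[of t]] lam by simp
qed

text \<open>The linear part moves by \<open>2 / W\<close> on at most \<open>W\<close> steps, the
  square root part contributes the harmonic sum, and
  \<open>(u + v)\<^sup>2 \<le> 2 * u\<^sup>2 + 2 * v\<^sup>2\<close> separates the two.\<close>

lemma sum_ramp_increments:
  "(\<Sum>d<N. (ramp d - ramp (Suc d))\<^sup>2) \<le> 8 / real W + 2 / lam\<^sup>2 * (\<Sum>d<N. 1 / real (Suc d))"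
proof -
  have step: "(ramp d - ramp (Suc d))\<^sup>2
      \<le> (if d < W then 8 / (real W)\<^sup>2 else 0) + 2 / lam\<^sup>2 * (1 / real (Suc d))" for d
  proof (cases "d < W")
    case True
    define u where "u = 2 / real W"
    define v where "v = (sqrt (real (Suc d)) - sqrt (real d)) / lam"
    \<comment> \<open>Truncation at 0 is 1-Lipschitz, so the untruncated expressions may be
      compared.\<close>
    have "\<bar>ramp d - ramp (Suc d)\<bar> \<le> \<bar>u + v\<bar>"
    proof -
      have "(1 - 2 * real d / real W - sqrt (real d) / lam)
          - (1 - 2 * real (Suc d) / real W - sqrt (real (Suc d)) / lam) = u + v"
        by (simp add: u_def v_def add_divide_distrib diff_divide_distrib)
      then show ?thesis
        unfolding ramp_def by linarith
    qed
    then have "(ramp d - ramp (Suc d))\<^sup>2 \<le> (u + v)\<^sup>2"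
      by (simp add: abs_le_square_iff)
    also have "\<dots> \<le> 2 * u\<^sup>2 + 2 * v\<^sup>2"
      using zero_le_power2[of "u - v"] by (simp add: power2_eq_square algebra_simps)
    also have "2 * u\<^sup>2 = 8 / (real W)\<^sup>2"
      by (simp add: u_def power_divide)
    also have "v\<^sup>2 \<le> 1 / real (Suc d) / lam\<^sup>2"
      unfolding v_def power_divide by (intro divide_right_mono sqrt_Suc_diff_square_le) auto
    finally show ?thesis
      using True by (simp add: mult_ac)
  next
    case False
    then show ?thesis
      by (simp add: ramp_eq_0)
  qed
  have "(\<Sum>d<N. if d < W then 8 / (real W)\<^sup>2 else 0) = (\<Sum>d\<in>{..<N} \<inter> {..<W}. 8 / (real W)\<^sup>2)"
    unfolding sum.inter_restrict[OF finite_lessThan] by (intro sum.cong) auto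
  also have "\<dots> \<le> (\<Sum>d<W. 8 / (real W)\<^sup>2)"
    by (intro sum_mono2) auto
  also have "\<dots> = 8 / real W"
    using W by (simp add: power2_eq_square)
  finally have "(\<Sum>d<N. if d < W then 8 / (real W)\<^sup>2 else 0) \<le> 8 / real W" .
  moreover have "(\<Sum>d<N. (ramp d - ramp (Suc d))\<^sup>2) \<le>
      (\<Sum>d<N. (if d < W then 8 / (real W)\<^sup>2 else 0) + 2 / lam\<^sup>2 * (1 / real (Suc d)))"
    by (intro sum_mono step)
  ultimately show ?thesis
    by (simp add: sum.distrib sum_distrib_left)
qed

text \<open>The increment at \<open>i\<close> sees at most one jump with \<open>j \<le> i\<close>
  and at most one with \<open>i < j\<close>, so the cross terms vanish on each side. One factor 2
  comes from adding the two sides, the other from the two flanks of every jump.\<close>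

lemma sum_dual_increments:
  assumes \<sigma>: "\<And>j. \<bar>\<sigma> j\<bar> \<le> 1"
  shows "(\<Sum>i<n. (dual \<sigma> i - dual \<sigma> (Suc i))\<^sup>2)
    \<le> 4 * real (card S) * (8 / real W + 2 / lam\<^sup>2 * (\<Sum>d<n. 1 / real (Suc d)))"
proof -
  define f where "f i j = ramp (gap i j) - ramp (gap (Suc i) j)" for i j
  have f0: "f i j = 0" if "j + W \<le> i \<or> Suc i + W \<le> j" for i j
    using that by (auto simp: f_def ramp_eq_0 gap_def)
  have "(dual \<sigma> i - dual \<sigma> (Suc i))\<^sup>2 \<le> 2 * (\<Sum>j\<in>S. (f i j)\<^sup>2)" for i
  proof -
    let ?L = "{j \<in> S. j \<le> i}" and ?R = "{j \<in> S. i < j}"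
    have split: "sum g S = sum g ?L + sum g ?R" for g :: "nat \<Rightarrow> real"
      by (subst sum.union_disjoint[symmetric]) (auto intro!: sum.cong)
    have "f i j * f i k = 0" if "j \<in> ?L" "k \<in> ?L" "j \<noteq> k" for j k
      using that f0[of j i] f0[of k i] sep_S[of j k] sep_S[of k j] by (cases "j < k") auto
    then have L: "(\<Sum>j\<in>?L. \<sigma> j * f i j)\<^sup>2 = (\<Sum>j\<in>?L. (\<sigma> j * f i j)\<^sup>2)"
      by (intro sum_square_orthogonal) auto
    have "f i j * f i k = 0" if "j \<in> ?R" "k \<in> ?R" "j \<noteq> k" for j k
      using that f0[of j i] f0[of k i] sep_S[of j k] sep_S[of k j] by (cases "j < k") auto
    then have R: "(\<Sum>j\<in>?R. \<sigma> j * f i j)\<^sup>2 = (\<Sum>j\<in>?R. (\<sigma> j * f i j)\<^sup>2)"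
      by (intro sum_square_orthogonal) auto
    have "dual \<sigma> i - dual \<sigma> (Suc i) = (\<Sum>j\<in>S. \<sigma> j * f i j)"
      by (simp add: dual_def f_def sum_subtractf right_diff_distrib)
    also have "\<dots>\<^sup>2 \<le> 2 * (\<Sum>j\<in>?L. \<sigma> j * f i j)\<^sup>2 + 2 * (\<Sum>j\<in>?R. \<sigma> j * f i j)\<^sup>2"
      unfolding split[of "\<lambda>j. \<sigma> j * f i j"]
      using zero_le_power2[of "(\<Sum>j\<in>?L. \<sigma> j * f i j) - (\<Sum>j\<in>?R. \<sigma> j * f i j)"]
      by (simp add: power2_eq_square algebra_simps)
    also have "\<dots> = 2 * (\<Sum>j\<in>S. (\<sigma> j * f i j)\<^sup>2)"
      unfolding L R split[of "\<lambda>j. (\<sigma> j * f i j)\<^sup>2"] by simp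
    also have "\<dots> \<le> 2 * (\<Sum>j\<in>S. (f i j)\<^sup>2)"
    proof (intro mult_left_mono sum_mono)
      fix j
      have "(\<sigma> j)\<^sup>2 \<le> 1"
        using \<sigma>[of j] by (simp add: abs_square_le_1)
      then show "(\<sigma> j * f i j)\<^sup>2 \<le> (f i j)\<^sup>2"
        by (simp add: power_mult_distrib mult_left_le_one_le)
    qed simp
    finally show ?thesis .
  qed
  then have "(\<Sum>i<n. (dual \<sigma> i - dual \<sigma> (Suc i))\<^sup>2) \<le> (\<Sum>i<n. 2 * (\<Sum>j\<in>S. (f i j)\<^sup>2))"
    by (intro sum_mono)
  also have "\<dots> = 2 * (\<Sum>j\<in>S. \<Sum>i<n. (f i j)\<^sup>2)"
    by (subst sum.swap) (simp add: sum_distrib_left)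
  also have "\<dots> \<le> 2 * (\<Sum>j\<in>S. 2 * (\<Sum>d<n. (ramp d - ramp (Suc d))\<^sup>2))"
  proof (intro mult_left_mono sum_mono)
    fix j
    assume "j \<in> S"
    then have j: "j < n"
      using S by auto
    have "(\<Sum>i<n. (f i j)\<^sup>2) = (\<Sum>i<j. (f i j)\<^sup>2) + (\<Sum>i=j..<n. (f i j)\<^sup>2)"
      using j by (simp add: lessThan_atLeast0 sum.atLeastLessThan_concat)
    also have "(\<Sum>i<j. (f i j)\<^sup>2) = (\<Sum>d<j. (ramp d - ramp (Suc d))\<^sup>2)"
      by (rule sum.reindex_bij_witness[of _ "\<lambda>d. j - Suc d" "\<lambda>i. j - Suc i"])
        (auto simp: f_def gap_def power2_commute Suc_diff_Suc)
    also have "(\<Sum>i=j..<n. (f i j)\<^sup>2) = (\<Sum>d<n - j. (ramp d - ramp (Suc d))\<^sup>2)"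
      by (rule sum.reindex_bij_witness[of _ "\<lambda>d. d + j" "\<lambda>i. i - j"])
        (auto simp: f_def gap_def Suc_diff_le)
    also have "(\<Sum>d<j. (ramp d - ramp (Suc d))\<^sup>2) \<le> (\<Sum>d<n. (ramp d - ramp (Suc d))\<^sup>2)"
      using j by (intro sum_mono2) auto
    also have "(\<Sum>d<n - j. (ramp d - ramp (Suc d))\<^sup>2) \<le> (\<Sum>d<n. (ramp d - ramp (Suc d))\<^sup>2)"
      by (intro sum_mono2) auto
    finally show "(\<Sum>i<n. (f i j)\<^sup>2) \<le> 2 * (\<Sum>d<n. (ramp d - ramp (Suc d))\<^sup>2)"
      by simp
  qed simp
  also have "\<dots> = 4 * real (card S) * (\<Sum>d<n. (ramp d - ramp (Suc d))\<^sup>2)"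
    by simp
  also have "\<dots> \<le> 4 * real (card S) * (8 / real W + 2 / lam\<^sup>2 * (\<Sum>d<n. 1 / real (Suc d)))"
    by (intro mult_left_mono sum_ramp_increments) auto
  finally show ?thesis .
qed

text \<open>At a jump this is the subgradient inequality for the absolute value. Off the jumps
  \<open>a\<close> does not move: the share \<open>\<bar>dual \<sigma> t\<bar>\<close> of the
  variation of \<open>x\<close> pays for the inner product, and the share
  \<open>1 - \<bar>dual \<sigma> t\<bar>\<close> is left over.\<close>

lemma total_variation_dual:
  assumes jumps: "S = {t \<in> {1..<n}. a t \<noteq> a (t - 1)}"
    and \<sigma>: "\<sigma> = (\<lambda>t. sgn (a t - a (t - 1)))"
  shows "(\<Sum>t=1..<n. \<bar>a t - a (t - 1)\<bar>) - (\<Sum>t=1..<n. \<bar>(a t + x t) - (a (t - 1) + x (t - 1))\<bar>)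
    \<le> - (\<Sum>t=1..<n. dual \<sigma> t * (x t - x (t - 1)))
      - (\<Sum>t\<in>{1..<n} - S. (1 - \<bar>dual \<sigma> t\<bar>) * \<bar>x t - x (t - 1)\<bar>)"
proof -
  have "\<bar>a t - a (t - 1)\<bar> - \<bar>(a t + x t) - (a (t - 1) + x (t - 1))\<bar>
      \<le> - (dual \<sigma> t * (x t - x (t - 1)))
        - (if t \<in> {1..<n} - S then (1 - \<bar>dual \<sigma> t\<bar>) * \<bar>x t - x (t - 1)\<bar> else 0)"
    if t: "t \<in> {1..<n}" for t
  proof (cases "t \<in> S")
    case True
    let ?d = "a t - a (t - 1)" and ?y = "x t - x (t - 1)"
    have "\<bar>?d\<bar> - \<bar>?d + ?y\<bar> \<le> - (sgn ?d * ?y)"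
      by (cases "?d > 0"; cases "?d = 0") (auto simp: sgn_if)
    moreover have eq: "(a t + x t) - (a (t - 1) + x (t - 1)) = ?d + ?y"
      by simp
    ultimately show ?thesis
      unfolding eq dual_jump[OF True] \<sigma> using True by simp
  next
    case False
    then have "a t = a (t - 1)"
      using jumps t by auto
    moreover have "dual \<sigma> t * (x t - x (t - 1)) \<le> \<bar>dual \<sigma> t\<bar> * \<bar>x t - x (t - 1)\<bar>"
      by (metis abs_ge_self abs_mult)
    ultimately show ?thesis
      using t False by (simp add: algebra_simps)
  qed
  then have "(\<Sum>t=1..<n. \<bar>a t - a (t - 1)\<bar> - \<bar>(a t + x t) - (a (t - 1) + x (t - 1))\<bar>)
      \<le> (\<Sum>t=1..<n. - (dual \<sigma> t * (x t - x (t - 1)))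
        - (if t \<in> {1..<n} - S then (1 - \<bar>dual \<sigma> t\<bar>) * \<bar>x t - x (t - 1)\<bar> else 0))"
    by (rule sum_mono)
  also have "\<dots> = - (\<Sum>t=1..<n. dual \<sigma> t * (x t - x (t - 1)))
      - (\<Sum>t\<in>{1..<n} \<inter> ({1..<n} - S). (1 - \<bar>dual \<sigma> t\<bar>) * \<bar>x t - x (t - 1)\<bar>)"
    by (simp only: sum_subtractf sum_negf sum.inter_restrict[OF finite_atLeastLessThan])
  also have "{1..<n} \<inter> ({1..<n} - S) = {1..<n} - S"
    by blast
  finally show ?thesis
    by (simp only: sum_subtractf)
qed

end

subsection \<open>Thresholded noise\<close>

text \<open>Both \<open>t\<close> and \<open>s\<close> exceed the start of their block by less than
  \<open>L\<close>, so passing to the block starts adds less than \<open>L\<close> to the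
  distance.\<close>

lemma gap_blocks:
  assumes "t div L = p" "0 < L"
  shows "L * gap p (s div L) \<le> gap t s + L"
proof -
  have t: "t = L * p + t mod L" "t mod L < L"
    using assms by auto
  have s: "s = L * (s div L) + s mod L" "s mod L < L"
    using assms by auto
  consider "p \<le> s div L" | "s div L \<le> p"
    by linarith
  then show ?thesis
  proof cases
    case 1
    then have "gap p (s div L) = s div L - p"
      by (simp add: gap_def)
    then have "L * gap p (s div L) = L * (s div L) - L * p"
      by (simp add: diff_mult_distrib2)
    also have "\<dots> \<le> (s - t) + L"
      using t s by linarith
    finally show ?thesis
      by (simp add: gap_def)
  next
    case 2
    then have "gap p (s div L) = p - s div L"
      by (simp add: gap_def)
    then have "L * gap p (s div L) = L * p - L * (s div L)"
      by (simp add: diff_mult_distrib2)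
    also have "\<dots> \<le> (t - s) + L"
      using t s by linarith
    finally show ?thesis
      by (simp add: gap_def)
  qed
qed

lemma div_eq_of_interior:
  fixes t :: nat
  assumes "t \<in> {p * L<..<Suc p * L}"
  shows "t div L = p"
  using assms by (intro div_nat_eqI) (auto simp: mult.commute)

text \<open>The squared ratio of the block length \<open>l\<close> to a scale
  \<open>l * (q - 1)\<close>, as it arises from a position \<open>q\<close> blocks away; the same
  block and its neighbours get the trivial value 1.\<close>

definition decay :: "nat \<Rightarrow> real" where
  "decay q = (if q \<le> 1 then 1 else 1 / (real q - 1)\<^sup>2)"

lemma decay_nonneg: "0 \<le> decay q"
  by (simp add: decay_def)

lemma sum_decay: "(\<Sum>q<k. decay q) \<le> 4"
proof -
  \<comment> \<open>The terms for \<open>q \<le> 2\<close> are 1 each, which is \<open>4 - 1\<close>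
    at \<open>k = 0\<close>; the later ones telescope.\<close>
  have *: "(\<Sum>q<k + 3. decay q) \<le> 4 - 1 / (real k + 1)" for k
  proof (induction k)
    case 0
    then show ?case
      by (simp add: decay_def eval_nat_numeral)
  next
    case (Suc k)
    have "decay (k + 3) = 1 / (real k + 2)\<^sup>2"
      by (simp add: decay_def)
    also have "\<dots> \<le> 1 / (real k + 1) - 1 / (real k + 2)"
      by (simp add: divide_simps power2_eq_square)
    finally have "decay (k + 3) + (4 - 1 / (real k + 1)) \<le> 4 - 1 / (real (Suc k) + 1)"
      by (simp add: add.commute)
    moreover have "(\<Sum>q<Suc k + 3. decay q) = (\<Sum>q<k + 3. decay q) + decay (k + 3)"
      unfolding add_Suc by (rule sum.lessThan_Suc)
    ultimately show ?case
      using Suc by linarith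
  qed
  have "(\<Sum>q<k. decay q) \<le> (\<Sum>q<k + 3. decay q)"
    by (intro sum_mono2 decay_nonneg) auto
  also have "\<dots> \<le> 4"
    using *[of k] by (rule order_trans) simp
  finally show ?thesis .
qed

text \<open>Splitting at \<open>q\<close> gives two one-sided sums, each bounded by
  \<open>sum_decay\<close>.\<close>

lemma sum_decay_gap: "(\<Sum>p<k. decay (gap p q)) \<le> 8"
proof -
  have "(\<Sum>p<k. decay (gap p q)) \<le> (\<Sum>p<k + q. decay (gap p q))"
    by (intro sum_mono2 decay_nonneg) auto
  also have "\<dots> = (\<Sum>p<q. decay (gap p q)) + (\<Sum>p=q..<k + q. decay (gap p q))"
    by (simp add: lessThan_atLeast0 sum.atLeastLessThan_concat)
  also have "(\<Sum>p<q. decay (gap p q)) = (\<Sum>i<q. decay (Suc i))"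
    by (rule sum.reindex_bij_witness[of _ "\<lambda>i. q - Suc i" "\<lambda>p. q - Suc p"])
      (auto simp: gap_def Suc_diff_Suc)
  also have "\<dots> \<le> (\<Sum>i<Suc q. decay i)"
    by (subst sum.lessThan_Suc_shift) (simp add: decay_nonneg)
  also have "\<dots> \<le> 4"
    by (rule sum_decay)
  also have "(\<Sum>p=q..<k + q. decay (gap p q)) = (\<Sum>i<k. decay i)"
    by (rule sum.reindex_bij_witness[of _ "\<lambda>i. i + q" "\<lambda>p. p - q"]) (auto simp: gap_def)
  also have "\<dots> \<le> 4"
    by (rule sum_decay)
  finally show ?thesis
    by simp
qed

text \<open>The growth of the fourth root of the block length from one level to the next.\<close>

definition geo_ratio :: real where
  "geo_ratio = 2 powr (1 / 4)"

text \<open>The inverse of the geometric series bound \<open>geo_ratio / (geo_ratio - 1)\<close>, so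
  that the thresholds around one edge add up to \<open>sqrt (edge_scale t)\<close> with constant
  1.\<close>

definition geo_const :: real where
  "geo_const = (geo_ratio - 1) / geo_ratio"

lemma geo_ratio: "1 < geo_ratio"
  by (simp add: geo_ratio_def)

lemma geo_const: "0 < geo_const" "geo_const \<le> 1"
  using geo_ratio by (auto simp: geo_const_def)

section \<open>Thresholds for the dyadic blocks and the size of the excess\<close>

context spaced_jumps
begin

text \<open>
  A lower bound for \<open>edge_scale\<close> on the interior edges of the \<open>p\<close>-th dyadic block of length \<open>2 ^ Suc j\<close>,
  in terms of the distance in blocks to the elements of \<open>T\<close>.
\<close>

definition block_scale :: "nat \<Rightarrow> nat \<Rightarrow> real" where
  "block_scale j p =
     Min (insert (lam\<^sup>2) ((\<lambda>s. 2 ^ Suc j * (real (gap p (s div 2 ^ Suc j)) - 1)) ` T))"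

text \<open>On a block longer than its scale the whole coefficient counts as excess; in the other
  case the ratio under the fourth root is at least 1.\<close>

definition threshold :: "nat \<Rightarrow> nat \<Rightarrow> real" where
  "threshold j p = (if block_scale j p < 2 ^ Suc j then 0
     else geo_const * (block_scale j p / 2 ^ Suc j) powr (1 / 4))"

lemma threshold_nonneg: "0 \<le> threshold j p"
  using geo_const by (simp add: threshold_def)

text \<open>The one block subtracted in \<open>block_scale\<close> pays for the rounding in
  \<open>gap_blocks\<close>.\<close>

lemma block_scale_le_edge_scale:
  assumes "t \<in> {p * 2 ^ Suc j<..<Suc p * 2 ^ Suc j}"
  shows "block_scale j p \<le> edge_scale t"
proof -
  have "block_scale j p \<le> real (gap t s)" if "s \<in> T" for s
  proof -
    have "block_scale j p \<le> 2 ^ Suc j * (real (gap p (s div 2 ^ Suc j)) - 1)"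
      unfolding block_scale_def using that by (intro Min_le) auto
    also have "real (2 ^ Suc j * gap p (s div 2 ^ Suc j)) \<le> real (gap t s + 2 ^ Suc j)"
      using gap_blocks[OF div_eq_of_interior[OF assms], of s] by (simp only: of_nat_le_iff) simp
    then have "2 ^ Suc j * (real (gap p (s div 2 ^ Suc j)) - 1) \<le> real (gap t s)"
      by (simp add: algebra_simps)
    finally show ?thesis .
  qed
  moreover have "block_scale j p \<le> lam\<^sup>2"
    unfolding block_scale_def by (intro Min_le) auto
  ultimately show ?thesis
    unfolding edge_scale_def by (subst Min_ge_iff) auto
qed

text \<open>With \<open>l = 2 ^ Suc j\<close> and block scale \<open>B \<le> D\<close>, one has
  \<open>(B / l) powr (1 / 4) * sqrt l \<le> sqrt D * (l / D) powr (1 / 4)\<close>, and the last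
  root equals \<open>c * geo_ratio ^ j\<close>. Over the levels these bounds form a geometric
  sequence that stops once \<open>l\<close> exceeds \<open>D\<close>.\<close>

lemma threshold_le:
  assumes "t \<in> {p * 2 ^ Suc j<..<Suc p * 2 ^ Suc j}"
  defines "D \<equiv> edge_scale t"
  defines "c \<equiv> (2 / D) powr (1 / 4)"
  shows "threshold j p * sqrt (2 ^ Suc j)
    \<le> geo_const * sqrt D * (if c * geo_ratio ^ j \<le> 1 then c * geo_ratio ^ j else 0)"
proof (cases "block_scale j p < 2 ^ Suc j")
  case True
  then show ?thesis
    using geo_const geo_ratio edge_scale_nonneg[of t] by (simp add: threshold_def c_def D_def)
next
  case False
  let ?l = "2 ^ Suc j :: real"
  have B: "?l \<le> block_scale j p" "block_scale j p \<le> D" "0 < D"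
    using False block_scale_le_edge_scale[OF assms(1)] zero_less_power[of "2::real" "Suc j"]
    by (auto simp: D_def simp del: power_Suc zero_less_power)
  have "c * geo_ratio ^ j = (?l / D) powr (1 / 4)"
  proof -
    have "geo_ratio ^ j = (2 ^ j) powr (1 / 4)"
      by (simp add: geo_ratio_def powr_powr powr_realpow[symmetric] mult.commute)
    then show ?thesis
      using B by (simp add: c_def powr_mult[symmetric])
  qed
  moreover have "(?l / D) powr (1 / 4) \<le> 1"
    using B by (intro powr_le1) auto
  moreover have "(block_scale j p / ?l) powr (1 / 4) * sqrt ?l \<le> sqrt D * (?l / D) powr (1 / 4)"
  proof -
    have sqrt_eq: "sqrt x = x powr (1 / 4) * x powr (1 / 4)" if "x > 0" for x :: real
      using that by (simp add: powr_add[symmetric] powr_half_sqrt)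
    have "(block_scale j p / ?l) powr (1 / 4) * sqrt ?l \<le> (D / ?l) powr (1 / 4) * sqrt ?l"
      using B zero_less_power[of "2::real" "Suc j"]
      by (intro mult_right_mono powr_mono2 divide_right_mono divide_nonneg_pos)
        (auto simp del: power_Suc zero_less_power)
    also have "\<dots> = D powr (1 / 4) * ?l powr (1 / 4)"
      using B(3) sqrt_eq[of ?l] by (simp add: powr_divide del: power_Suc)
    also have "\<dots> = sqrt D * (?l / D) powr (1 / 4)"
      using B(3) sqrt_eq[of D] by (simp add: powr_divide del: power_Suc)
    finally show ?thesis .
  qed
  then have "geo_const * ((block_scale j p / ?l) powr (1 / 4) * sqrt ?l)
      \<le> geo_const * (sqrt D * (?l / D) powr (1 / 4))"
    using geo_const by (intro mult_left_mono) auto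
  ultimately show ?thesis
    using False by (simp add: threshold_def mult.assoc del: power_Suc)
qed

text \<open>Each edge is an interior edge of at most one block per level.\<close>

lemma sum_threshold_le:
  "(\<Sum>j<m. \<Sum>p<2 ^ (m - Suc j).
      if t \<in> {p * 2 ^ Suc j<..<Suc p * 2 ^ Suc j} then threshold j p * sqrt (2 ^ Suc j) else 0)
    \<le> sqrt (edge_scale t)"
proof -
  define D where "D = edge_scale t"
  define c where "c = (2 / D) powr (1 / 4)"
  define b where "b j = (if c * geo_ratio ^ j \<le> 1 then c * geo_ratio ^ j else 0)" for j
  have D: "0 \<le> D"
    by (simp add: D_def edge_scale_nonneg)
  have b: "0 \<le> b j" for j
    using geo_ratio by (simp add: b_def c_def)
  have "(\<Sum>p<2 ^ (m - Suc j).
      if t \<in> {p * 2 ^ Suc j<..<Suc p * 2 ^ Suc j} then threshold j p * sqrt (2 ^ Suc j) else 0)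
    \<le> geo_const * sqrt D * b j" for j
  proof -
    have "(\<Sum>p<2 ^ (m - Suc j).
        if t \<in> {p * 2 ^ Suc j<..<Suc p * 2 ^ Suc j} then threshold j p * sqrt (2 ^ Suc j) else 0)
      \<le> (\<Sum>p<2 ^ (m - Suc j). if p = t div 2 ^ Suc j then geo_const * sqrt D * b j else 0)"
    proof (rule sum_mono)
      fix p
      have "0 \<le> geo_const * sqrt D * b j"
        using geo_const b D by simp
      then show "(if t \<in> {p * 2 ^ Suc j<..<Suc p * 2 ^ Suc j} then threshold j p * sqrt (2 ^ Suc j)
          else 0) \<le> (if p = t div 2 ^ Suc j then geo_const * sqrt D * b j else 0)"
        using threshold_le[of t p j, folded D_def, folded c_def, folded b_def]
          div_eq_of_interior[of t p "2 ^ Suc j"]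
        by (cases "t \<in> {p * 2 ^ Suc j<..<Suc p * 2 ^ Suc j}")
          (simp_all del: power_Suc greaterThanLessThan_iff mult_Suc)
    qed
    also have "\<dots> \<le> geo_const * sqrt D * b j"
      using geo_const b D by simp
    finally show ?thesis .
  qed
  then have "(\<Sum>j<m. \<Sum>p<2 ^ (m - Suc j).
      if t \<in> {p * 2 ^ Suc j<..<Suc p * 2 ^ Suc j} then threshold j p * sqrt (2 ^ Suc j) else 0)
    \<le> (\<Sum>j<m. geo_const * sqrt D * b j)"
    by (intro sum_mono)
  also have "\<dots> = geo_const * sqrt D * (\<Sum>j<m. b j)"
    by (simp add: sum_distrib_left)
  also have "\<dots> \<le> sqrt D"
  proof (cases "D = 0")
    case False
    then have "0 < c"
      using D by (simp add: c_def)
    then have "(\<Sum>j<m. b j) \<le> geo_ratio / (geo_ratio - 1)"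
      unfolding b_def by (rule sum_geometric_upto_one) (rule geo_ratio)
    then have "geo_const * sqrt D * (\<Sum>j<m. b j) \<le> geo_const * sqrt D * (geo_ratio / (geo_ratio - 1))"
      using geo_const D by (intro mult_left_mono) auto
    also have "\<dots> = sqrt D"
      using geo_ratio by (simp add: geo_const_def)
    finally show ?thesis .
  qed simp
  finally show ?thesis
    by (simp add: D_def)
qed

text \<open>The leading term is the squared coefficient of the constant function, to which no
  variation bound applies; it is kept in full.\<close>

definition noise_excess :: "nat \<Rightarrow> (nat \<Rightarrow> real) \<Rightarrow> real" where
  "noise_excess m e = (block_sum e m 0 / sqrt (2 ^ m))\<^sup>2
     + (\<Sum>j<m. \<Sum>p<2 ^ (m - Suc j). (excess (threshold j p) (haar e j p))\<^sup>2)"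

text \<open>The part of a noise coefficient below the threshold is paid for by the variation of
  \<open>x\<close> on the block, the excess by an eighth of the squared norm through Young's
  inequality. Exchanging the sums collects, for each edge, the thresholds of all blocks around
  it.\<close>

lemma inner_noise_le:
  assumes m: "n \<le> 2 ^ m" and x: "\<And>i. n \<le> i \<Longrightarrow> x i = 0"
  shows "(\<Sum>i<2 ^ m. e i * x i)
    \<le> (\<Sum>t\<in>{1..<n} - S. \<bar>x t - x (t - 1)\<bar> * sqrt (edge_scale t))
      + 2 * noise_excess m e + (\<Sum>i<n. (x i)\<^sup>2) / 8"
proof -
  let ?I = "\<lambda>j p. {p * 2 ^ Suc j<..<Suc p * 2 ^ Suc j}"
  let ?X = "\<lambda>j p. (excess (threshold j p) (haar e j p))\<^sup>2"
  define v where "v t = \<bar>x t - x (t - 1)\<bar>" for t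
  have v_nonneg: "0 \<le> v t" for t
    by (simp add: v_def)
  have young: "a * b \<le> 2 * a\<^sup>2 + b\<^sup>2 / 8" for a b :: real
    using zero_le_power2[of "4 * a - b"] by (simp add: power2_eq_square algebra_simps)
  have one: "haar e j p * haar x j p
      \<le> threshold j p * sqrt (2 ^ Suc j) * (\<Sum>t\<in>?I j p. v t) + (2 * ?X j p + (haar x j p)\<^sup>2 / 8)" for j p
  proof -
    have "haar e j p * haar x j p \<le> \<bar>haar e j p\<bar> * \<bar>haar x j p\<bar>"
      by (metis abs_ge_self abs_mult)
    also have "\<dots> \<le> (threshold j p + excess (threshold j p) (haar e j p)) * \<bar>haar x j p\<bar>"
      by (intro mult_right_mono) (auto simp: excess_def)
    also have "\<dots> = threshold j p * \<bar>haar x j p\<bar>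
        + excess (threshold j p) (haar e j p) * \<bar>haar x j p\<bar>"
      by (simp add: distrib_right)
    also have "threshold j p * \<bar>haar x j p\<bar>
        \<le> threshold j p * (sqrt (2 ^ Suc j) * (\<Sum>t\<in>?I j p. v t))"
      unfolding v_def by (intro mult_left_mono abs_haar_le_variation threshold_nonneg)
    also have "excess (threshold j p) (haar e j p) * \<bar>haar x j p\<bar>
        \<le> 2 * ?X j p + (haar x j p)\<^sup>2 / 8"
      using young[of _ "\<bar>haar x j p\<bar>"] by simp
    finally show ?thesis
      by (simp add: mult.assoc)
  qed
  have "(\<Sum>i<2 ^ m. e i * x i)
      = block_sum e m 0 / sqrt (2 ^ m) * (block_sum x m 0 / sqrt (2 ^ m))
        + (\<Sum>j<m. \<Sum>p<2 ^ (m - Suc j). haar e j p * haar x j p)"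
    by (subst haar_parseval) simp
  also have "\<dots> \<le> (2 * (block_sum e m 0 / sqrt (2 ^ m))\<^sup>2 + (block_sum x m 0 / sqrt (2 ^ m))\<^sup>2 / 8)
      + (\<Sum>j<m. \<Sum>p<2 ^ (m - Suc j). threshold j p * sqrt (2 ^ Suc j) * (\<Sum>t\<in>?I j p. v t)
          + (2 * ?X j p + (haar x j p)\<^sup>2 / 8))"
    by (intro add_mono sum_mono one young)
  also have "\<dots> = (\<Sum>j<m. \<Sum>p<2 ^ (m - Suc j). threshold j p * sqrt (2 ^ Suc j) * (\<Sum>t\<in>?I j p. v t))
      + 2 * noise_excess m e + (block_sum x m 0 * block_sum x m 0 / 2 ^ m
          + (\<Sum>j<m. \<Sum>p<2 ^ (m - Suc j). haar x j p * haar x j p)) / 8"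
    unfolding noise_excess_def
    by (simp add: sum.distrib sum_distrib_left sum_divide_distrib power_divide add_divide_distrib
        power2_eq_square[of "haar x _ _"] power2_eq_square[of "block_sum x _ _"])
  also have "block_sum x m 0 * block_sum x m 0 / 2 ^ m
      + (\<Sum>j<m. \<Sum>p<2 ^ (m - Suc j). haar x j p * haar x j p) = (\<Sum>i<2 ^ m. x i * x i)"
    by (rule haar_parseval[symmetric])
  also have "\<dots> = (\<Sum>i<n. (x i)\<^sup>2)"
    using m x by (intro sum.mono_neutral_cong_right) (auto simp: power2_eq_square not_less)
  also have "(\<Sum>j<m. \<Sum>p<2 ^ (m - Suc j). threshold j p * sqrt (2 ^ Suc j) * (\<Sum>t\<in>?I j p. v t))
      = (\<Sum>t\<in>{1..<2 ^ m}. v t * (\<Sum>j<m. \<Sum>p<2 ^ (m - Suc j).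
          if t \<in> ?I j p then threshold j p * sqrt (2 ^ Suc j) else 0))"
  proof -
    have "threshold j p * sqrt (2 ^ Suc j) * (\<Sum>t\<in>?I j p. v t) =
        (\<Sum>t\<in>{1..<2 ^ m}. v t * (if t \<in> ?I j p then threshold j p * sqrt (2 ^ Suc j) else 0))"
      if "j < m" "p < 2 ^ (m - Suc j)" for j p
    proof -
      have "Suc p * 2 ^ Suc j \<le> 2 ^ (m - Suc j) * 2 ^ Suc j"
        using that by (intro mult_right_mono) auto
      also have "\<dots> = (2 :: nat) ^ m"
        using that by (simp del: power_Suc flip: power_add)
      finally have "?I j p \<subseteq> {1..<2 ^ m}"
        by auto
      then have "(\<Sum>t\<in>?I j p. v t) = (\<Sum>t\<in>{1..<2 ^ m}. if t \<in> ?I j p then v t else 0)"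
        by (subst sum.inter_restrict[symmetric]) (auto simp: Int_absorb1)
      then show ?thesis
        by (simp add: sum_distrib_left mult_ac if_distrib cong: if_cong del: power_Suc)
    qed
    then have "(\<Sum>j<m. \<Sum>p<2 ^ (m - Suc j). threshold j p * sqrt (2 ^ Suc j) * (\<Sum>t\<in>?I j p. v t))
        = (\<Sum>j<m. \<Sum>p<2 ^ (m - Suc j). \<Sum>t\<in>{1..<2 ^ m}.
            v t * (if t \<in> ?I j p then threshold j p * sqrt (2 ^ Suc j) else 0))"
      by (intro sum.cong refl) simp
    also have "\<dots> = (\<Sum>j<m. \<Sum>t\<in>{1..<2 ^ m}. \<Sum>p<2 ^ (m - Suc j).
            v t * (if t \<in> ?I j p then threshold j p * sqrt (2 ^ Suc j) else 0))"
      by (intro sum.cong refl sum.swap)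
    also have "\<dots> = (\<Sum>t\<in>{1..<2 ^ m}. \<Sum>j<m. \<Sum>p<2 ^ (m - Suc j).
            v t * (if t \<in> ?I j p then threshold j p * sqrt (2 ^ Suc j) else 0))"
      by (rule sum.swap)
    finally show ?thesis
      by (simp add: sum_distrib_left)
  qed
  also have "\<dots> \<le> (\<Sum>t\<in>{1..<2 ^ m}. v t * sqrt (edge_scale t))"
    by (intro sum_mono mult_left_mono sum_threshold_le v_nonneg)
  \<comment> \<open>The scale is 0 on \<open>T\<close>, which removes the jumps and also the edge
    \<open>n\<close>, where \<open>x\<close> drops to its padding value 0. Beyond \<open>n\<close>
    both values of \<open>x\<close> are padding.\<close>
  also have "\<dots> = (\<Sum>t\<in>{1..<n} - S. v t * sqrt (edge_scale t))"
  proof (rule sum.mono_neutral_right)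
    show "\<forall>t\<in>{1..<2 ^ m} - ({1..<n} - S). v t * sqrt (edge_scale t) = 0"
    proof
      fix t
      assume t: "t \<in> {1..<2 ^ m} - ({1..<n} - S)"
      show "v t * sqrt (edge_scale t) = 0"
      proof (cases "t \<in> T")
        case False
        then have "n < t"
          using t by (auto simp: T_def)
        then show ?thesis
          using x by (simp add: v_def)
      qed (simp add: edge_scale_T)
    qed
  qed (use m in auto)
  finally show ?thesis
    by (simp add: v_def)
qed

text \<open>Up to the factor \<open>moment_const\<close> this bounds the second moment of the excess
  on the block.\<close>

definition cap :: "nat \<Rightarrow> nat \<Rightarrow> real" where
  "cap j p = (if block_scale j p < 2 ^ Suc j then 1 else (2 ^ Suc j / block_scale j p)\<^sup>2)"

text \<open>The minimum in \<open>block_scale\<close> is attained either at a position of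
  \<open>T\<close> or at \<open>lam\<^sup>2\<close>; the two summands cover these cases.\<close>

lemma cap_le:
  "cap j p \<le> (\<Sum>s\<in>T. decay (gap p (s div 2 ^ Suc j)))
     + (if 2 ^ Suc j \<le> lam\<^sup>2 then (2 ^ Suc j / lam\<^sup>2)\<^sup>2 else 1)"
proof -
  let ?l = "2 ^ Suc j :: real"
  have l: "0 < ?l"
    by simp
  have nn: "0 \<le> (\<Sum>s\<in>T. decay (gap p (s div 2 ^ Suc j)))"
    by (intro sum_nonneg decay_nonneg)
  have "block_scale j p \<in> insert (lam\<^sup>2) ((\<lambda>s. ?l * (real (gap p (s div 2 ^ Suc j)) - 1)) ` T)"
    unfolding block_scale_def by (rule Min_in) auto
  then consider "block_scale j p = lam\<^sup>2"
    | s where "s \<in> T" "block_scale j p = ?l * (real (gap p (s div 2 ^ Suc j)) - 1)"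
    by auto
  then show ?thesis
  proof cases
    case 1
    then show ?thesis
      using nn unfolding cap_def by (auto simp del: power_Suc)
  next
    case (2 s)
    let ?q = "gap p (s div 2 ^ Suc j)"
    have "cap j p \<le> decay ?q"
    proof (cases "?q \<le> 1")
      case True
      then have "?l * (real ?q - 1) \<le> 0"
        using l by (intro mult_nonneg_nonpos) auto
      then show ?thesis
        using True l unfolding cap_def decay_def 2(2) by (simp del: power_Suc)
    next
      case False
      then have "?l * 1 \<le> ?l * (real ?q - 1)"
        using l by (intro mult_left_mono) auto
      then show ?thesis
        using False l unfolding cap_def decay_def 2(2) by (simp add: power_divide del: power_Suc)
    qed
    also have "\<dots> \<le> (\<Sum>s\<in>T. decay (gap p (s div 2 ^ Suc j)))"
      using 2(1) by (intro member_le_sum decay_nonneg) auto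
    finally show ?thesis
      by (simp add: add_increasing2 del: power_Suc)
  qed
qed

text \<open>On each level a position of \<open>T\<close> costs at most 8. For the cap, a level has
  \<open>2 ^ m / l\<close> blocks of length \<open>l\<close>; with
  \<open>z = l / lam\<^sup>2\<close> it costs \<open>2 ^ m / lam\<^sup>2\<close> times
  \<open>z\<close> or \<open>1 / z\<close>, whichever is at most 1. Both sequences are geometric
  with sum at most 2.\<close>

lemma sum_cap_le: "(\<Sum>j<m. \<Sum>p<2 ^ (m - Suc j). cap j p) \<le> 8 * real m * real (card T) + 4 * 2 ^ m / lam\<^sup>2"
proof -
  define z where "z j = 2 ^ Suc j / lam\<^sup>2" for j
  have z: "0 < z j" for j
    using lam by (simp add: z_def)
  have level: "(\<Sum>p<2 ^ (m - Suc j). cap j p) \<le> 8 * real (card T)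
      + 2 ^ m / lam\<^sup>2 * ((if z j \<le> 1 then z j else 0) + (if 1 \<le> z j then 1 / z j else 0))"
    if "j < m" for j
  proof -
    let ?N = "2 ^ (m - Suc j) :: nat"
    let ?g = "if 2 ^ Suc j \<le> lam\<^sup>2 then (2 ^ Suc j / lam\<^sup>2)\<^sup>2 else 1 :: real"
    have "(\<Sum>p<?N. cap j p) \<le> (\<Sum>p<?N. (\<Sum>s\<in>T. decay (gap p (s div 2 ^ Suc j))) + ?g)"
      by (intro sum_mono cap_le)
    also have "\<dots> = (\<Sum>s\<in>T. \<Sum>p<?N. decay (gap p (s div 2 ^ Suc j))) + real ?N * ?g"
      by (simp add: sum.distrib sum.swap[of _ T] del: power_Suc)
    also have "(\<Sum>s\<in>T. \<Sum>p<?N. decay (gap p (s div 2 ^ Suc j))) \<le> (\<Sum>s\<in>T. 8)"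
      by (intro sum_mono sum_decay_gap)
    also have "real ?N * ?g
        \<le> 2 ^ m / lam\<^sup>2 * ((if z j \<le> 1 then z j else 0) + (if 1 \<le> z j then 1 / z j else 0))"
    proof -
      have "real ?N * 2 ^ Suc j = 2 ^ m"
        using that by (simp del: power_Suc flip: power_add)
      then have N: "real ?N = 2 ^ m / lam\<^sup>2 / z j"
        using lam by (simp add: z_def field_simps del: power_Suc)
      have zle: "2 ^ Suc j \<le> lam\<^sup>2 \<longleftrightarrow> z j \<le> 1"
        using lam by (simp add: z_def field_simps del: power_Suc)
      have "?g = (if z j \<le> 1 then (z j)\<^sup>2 else 1)"
        unfolding zle by (simp add: z_def del: power_Suc)
      moreover have "0 \<le> (2 ^ m / lam\<^sup>2 :: real)"
        by simp
      ultimately show ?thesis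
        unfolding N using z[of j]
        by (auto simp: power2_eq_square divide_simps)
    qed
    finally show ?thesis
      by (simp add: mult.commute)
  qed
  have "(\<Sum>j<m. \<Sum>p<2 ^ (m - Suc j). cap j p) \<le> (\<Sum>j<m. 8 * real (card T)
      + 2 ^ m / lam\<^sup>2 * ((if z j \<le> 1 then z j else 0) + (if 1 \<le> z j then 1 / z j else 0)))"
    by (intro sum_mono level) auto
  also have "\<dots> = 8 * real m * real (card T) + 2 ^ m / lam\<^sup>2 *
      ((\<Sum>j<m. if z j \<le> 1 then z j else 0) + (\<Sum>j<m. if 1 \<le> z j then 1 / z j else 0))"
    unfolding sum.distrib sum_distrib_left[symmetric] by simp
  also have "\<dots> \<le> 8 * real m * real (card T) + 2 ^ m / lam\<^sup>2 * (2 + 2)"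
  proof (intro add_left_mono mult_left_mono add_mono)
    have z_eq: "z j = 2 / lam\<^sup>2 * 2 ^ j" for j
      by (simp add: z_def)
    have c: "0 < 2 / lam\<^sup>2"
      using lam by simp
    show "(\<Sum>j<m. if z j \<le> 1 then z j else 0) \<le> 2"
      unfolding z_eq using sum_geometric_upto_one[OF c, of 2 m] by simp
    have "(\<Sum>j<m. if 1 \<le> z j then 1 / z j else 0) \<le> 2 * min 1 (1 / (2 / lam\<^sup>2))"
      unfolding z_eq by (rule sum_geometric_from_one[OF c])
    also have "\<dots> \<le> 2"
      by simp
    finally show "(\<Sum>j<m. if 1 \<le> z j then 1 / z j else 0) \<le> 2" .
  qed simp
  finally show ?thesis
    by (simp add: mult.commute)
qed

end

subsection \<open>Error bound for a chain\<close>

lemma sum_inverse_le_ln: "1 \<le> n \<Longrightarrow> (\<Sum>d<n. 1 / real (Suc d)) \<le> 1 + ln (real n)"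
proof (induction n rule: nat_induct_at_least)
  case (Suc n)
  have "ln (real n / real (Suc n)) \<le> real n / real (Suc n) - 1"
    using Suc.hyps by (intro ln_le_minus_one) auto
  also have "\<dots> = - (1 / real (Suc n))"
    by (simp add: field_simps)
  finally have "1 / real (Suc n) \<le> ln (real (Suc n)) - ln (real n)"
    using Suc.hyps by (simp add: ln_div)
  then show ?case
    using Suc.IH by simp
qed simp

text \<open>Coefficients of norm 1 are what \<open>mgf_linear_combination\<close> can use;
  \<open>haar_linear\<close> serves the same purpose.\<close>

lemma block_sum_linear:
  obtains c A where "finite A" "(\<Sum>i\<in>A. (c i)\<^sup>2) = 1"
    "\<And>x. block_sum x m p / sqrt (2 ^ m) = (\<Sum>i\<in>A. c i * x i)"
proof
  show "(\<Sum>i = p * 2 ^ m..<Suc p * 2 ^ m. (1 / sqrt (2 ^ m))\<^sup>2) = 1"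
    by (simp add: power_divide)
  show "block_sum x m p / sqrt (2 ^ m) = (\<Sum>i = p * 2 ^ m..<Suc p * 2 ^ m. 1 / sqrt (2 ^ m) * x i)"
    for x
    by (simp add: block_sum_def sum_divide_distrib)
qed simp

lemma haar_linear:
  obtains c A where "finite A" "(\<Sum>i\<in>A. (c i)\<^sup>2) = 1" "\<And>x. haar x j p = (\<Sum>i\<in>A. c i * x i)"
proof
  let ?A = "{2 * p * 2 ^ j..<Suc (2 * p) * 2 ^ j}"
  let ?B = "{(2 * p + 1) * 2 ^ j..<Suc (2 * p + 1) * 2 ^ j}"
  let ?c = "\<lambda>i. (if i \<in> ?A then 1 else -1) / sqrt (2 ^ Suc j)"
  have disj: "?A \<inter> ?B = {}"
    by auto
  have split: "sum f (?A \<union> ?B) = sum f ?A + sum f ?B" for f :: "nat \<Rightarrow> real"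
    using disj by (intro sum.union_disjoint) auto
  have c: "?c i = - 1 / sqrt (2 ^ Suc j)" if "i \<in> ?B" for i
    using that disj by auto
  have "(\<Sum>i\<in>?A \<union> ?B. (?c i)\<^sup>2) = (\<Sum>i\<in>?A \<union> ?B. 1 / 2 ^ Suc j)"
    by (intro sum.cong) (auto simp: power_divide simp del: power_Suc)
  then show "(\<Sum>i\<in>?A \<union> ?B. (?c i)\<^sup>2) = 1"
    by (simp only: split) simp
  fix x :: "nat \<Rightarrow> real"
  have "(\<Sum>i\<in>?A. ?c i * x i) = (\<Sum>i\<in>?A. x i) / sqrt (2 ^ Suc j)"
    by (simp add: sum_divide_distrib)
  moreover have "(\<Sum>i\<in>?B. ?c i * x i) = - (\<Sum>i\<in>?B. x i) / sqrt (2 ^ Suc j)"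
    unfolding sum_negf[symmetric] sum_divide_distrib by (intro sum.cong refl) (simp only: c, simp)
  ultimately show "haar x j p = (\<Sum>i\<in>?A \<union> ?B. ?c i * x i)"
    unfolding split by (simp add: haar_def block_sum_def diff_divide_distrib)
qed simp

text \<open>The numerator comes from \<open>excess_moment\<close>, the denominator from the eighth
  power of a threshold.\<close>

definition moment_const :: "real \<Rightarrow> real" where
  "moment_const C = 2 * fact 10 * exp C / geo_const ^ 8"

section \<open>Deterministic error bound and mean of the noise excess\<close>

context spaced_jumps
begin

text \<open>Holds for every noise vector; the noise enters the bound through
  \<open>noise_excess\<close> only. The variation left over by \<open>total_variation_dual\<close>
  cancels the one produced by \<open>inner_noise_le\<close>.\<close>

lemma estimation_error_le:
  assumes m: "n \<le> 2 ^ m"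
    and jumps: "S = {t \<in> {1..<n}. a t \<noteq> a (t - 1)}"
    and x: "\<And>i. n \<le> i \<Longrightarrow> x i = 0" and e: "\<And>i. n \<le> i \<Longrightarrow> e i = 0"
    and basic: "(\<Sum>i<n. (x i)\<^sup>2) / 2 \<le> (\<Sum>i<n. e i * x i)
      + lam * ((\<Sum>t=1..<n. \<bar>a t - a (t - 1)\<bar>)
        - (\<Sum>t=1..<n. \<bar>(a t + x t) - (a (t - 1) + x (t - 1))\<bar>))"
  shows "(\<Sum>i<n. (x i)\<^sup>2)
    \<le> 8 * noise_excess m e + 32 * real (card S) * (8 * (lam\<^sup>2 / real W) + 2 * (1 + ln (real n)))"
proof -
  define \<sigma> where "\<sigma> = (\<lambda>t. sgn (a t - a (t - 1)))"
  define G where "G i = dual \<sigma> i - dual \<sigma> (Suc i)" for i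
  define X where "X = (\<Sum>i<n. (x i)\<^sup>2)"
  define H where "H = (\<Sum>d<n. 1 / real (Suc d))"
  define V where "V = (\<Sum>t\<in>{1..<n} - S. (1 - \<bar>dual \<sigma> t\<bar>) * \<bar>x t - x (t - 1)\<bar>)"
  have \<sigma>1: "\<bar>\<sigma> j\<bar> \<le> 1" for j
    by (simp add: \<sigma>_def sgn_if)
  have "(\<Sum>t=1..<n. \<bar>a t - a (t - 1)\<bar>) - (\<Sum>t=1..<n. \<bar>(a t + x t) - (a (t - 1) + x (t - 1))\<bar>)
      \<le> - (\<Sum>i<n. x i * G i) - V"
    using total_variation_dual[OF jumps \<sigma>_def, of x] abel_summation_diff[OF n, of "dual \<sigma>" x]
    by (simp add: V_def G_def)
  then have "lam * ((\<Sum>t=1..<n. \<bar>a t - a (t - 1)\<bar>)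
        - (\<Sum>t=1..<n. \<bar>(a t + x t) - (a (t - 1) + x (t - 1))\<bar>)) \<le> lam * (- (\<Sum>i<n. x i * G i) - V)"
    using lam by (intro mult_left_mono) auto
  moreover have "lam * (- (\<Sum>i<n. x i * G i)) \<le> X / 8 + 2 * lam\<^sup>2 * (\<Sum>i<n. (G i)\<^sup>2)"
  proof -
    have "lam * - (x i * G i) \<le> (x i)\<^sup>2 / 8 + 2 * lam\<^sup>2 * (G i)\<^sup>2" for i
      using zero_le_power2[of "x i + 4 * lam * G i"] by (simp add: power2_eq_square algebra_simps)
    then have "(\<Sum>i<n. lam * - (x i * G i)) \<le> (\<Sum>i<n. (x i)\<^sup>2 / 8 + 2 * lam\<^sup>2 * (G i)\<^sup>2)"
      by (intro sum_mono)
    then show ?thesis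
      by (simp only: X_def sum.distrib sum_distrib_left sum_divide_distrib sum_negf[symmetric])
  qed
  moreover have "(\<Sum>i<n. e i * x i) \<le> lam * V + 2 * noise_excess m e + X / 8"
  proof -
    have "(\<Sum>i<n. e i * x i) = (\<Sum>i<2 ^ m. e i * x i)"
      using m e by (intro sum.mono_neutral_left) auto
    also have "\<dots> \<le> (\<Sum>t\<in>{1..<n} - S. \<bar>x t - x (t - 1)\<bar> * sqrt (edge_scale t))
        + 2 * noise_excess m e + X / 8"
      unfolding X_def by (rule inner_noise_le[OF m x])
    also have "(\<Sum>t\<in>{1..<n} - S. \<bar>x t - x (t - 1)\<bar> * sqrt (edge_scale t))
        \<le> (\<Sum>t\<in>{1..<n} - S. \<bar>x t - x (t - 1)\<bar> * (lam * (1 - \<bar>dual \<sigma> t\<bar>)))"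
      by (intro sum_mono mult_left_mono sqrt_edge_scale_le \<sigma>1) auto
    also have "\<dots> = lam * V"
      by (simp add: V_def sum_distrib_left mult_ac)
    finally show ?thesis
      by simp
  qed
  \<comment> \<open>The two terms \<open>lam * V\<close> cancel, and the two terms
    \<open>X / 8\<close> leave a quarter of \<open>X\<close> on the left; the inequality is then
    multiplied by 4.\<close>
  ultimately have "X \<le> 8 * noise_excess m e + 8 * (lam\<^sup>2 * (\<Sum>i<n. (G i)\<^sup>2))"
    using basic unfolding X_def[symmetric] by (simp add: right_diff_distrib)
  also have "lam\<^sup>2 * (\<Sum>i<n. (G i)\<^sup>2)
      \<le> lam\<^sup>2 * (4 * real (card S) * (8 / real W + 2 / lam\<^sup>2 * H))"
    unfolding G_def H_def by (intro mult_left_mono sum_dual_increments \<sigma>1) auto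
  also have "\<dots> = 4 * real (card S) * (8 * (lam\<^sup>2 / real W) + 2 * H)"
    using lam by (simp add: field_simps)
  also have "\<dots> \<le> 4 * real (card S) * (8 * (lam\<^sup>2 / real W) + 2 * (1 + ln (real n)))"
    using sum_inverse_le_ln[OF n] by (intro mult_left_mono) (auto simp: H_def)
  finally show ?thesis
    by (simp add: X_def)
qed

text \<open>Every Haar coefficient of the noise is a combination of norm at most 1 of independent
  variables, so \<open>excess_moment\<close> bounds each excess by a multiple of \<open>cap\<close>,
  and \<open>sum_cap_le\<close> adds these up.\<close>

lemma noise_excess_moment:
  fixes X :: "nat \<Rightarrow> 'b \<Rightarrow> real" and M :: "'b measure"
  assumes "prob_space M"
    and ind: "prob_space.indep_vars M (\<lambda>_. borel) X {..<n}"
    and mgf: "\<And>i t. i < n \<Longrightarrow> \<bar>t\<bar> \<le> 1 \<Longrightarrow> integrable M (\<lambda>\<omega>. exp (t * X i \<omega>))"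
      "\<And>i t. i < n \<Longrightarrow> \<bar>t\<bar> \<le> 1 \<Longrightarrow> integral\<^sup>L M (\<lambda>\<omega>. exp (t * X i \<omega>)) \<le> exp (C * t\<^sup>2)"
    and C: "0 \<le> C"
  defines "e \<equiv> \<lambda>\<omega> i. if i < n then X i \<omega> else 0"
  shows "integrable M (\<lambda>\<omega>. noise_excess m (e \<omega>))"
    and "integral\<^sup>L M (\<lambda>\<omega>. noise_excess m (e \<omega>))
      \<le> moment_const C * (1 + 8 * real m * real (card T) + 4 * 2 ^ m / lam\<^sup>2)"
proof -
  interpret prob_space M by fact
  have X[measurable]: "X i \<in> borel_measurable M" if "i < n" for i
    using ind that by (auto simp: indep_vars_def)
  have excess_linear: "integrable M (\<lambda>\<omega>. (excess \<tau> (\<Sum>i\<in>A. c i * e \<omega> i))\<^sup>2)" (is ?A)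
    "expectation (\<lambda>\<omega>. (excess \<tau> (\<Sum>i\<in>A. c i * e \<omega> i))\<^sup>2) \<le> 2 * fact 10 * exp C" (is ?B)
    "\<tau> > 0 \<longrightarrow> expectation (\<lambda>\<omega>. (excess \<tau> (\<Sum>i\<in>A. c i * e \<omega> i))\<^sup>2)
      \<le> 2 * fact 10 * exp C / \<tau> ^ 8" (is ?C)
    if A: "finite A" "(\<Sum>i\<in>A. (c i)\<^sup>2) = 1" and \<tau>: "0 \<le> \<tau>" for A \<tau> and c :: "nat \<Rightarrow> real"
  proof -
    let ?I = "A \<inter> {..<n}"
    \<comment> \<open>The padding entries of the noise are 0; restricting to indices below
      \<open>n\<close> can only decrease the norm of the coefficients.\<close>
    have eq: "(\<Sum>i\<in>A. c i * e \<omega> i) = (\<Sum>i\<in>?I. c i * X i \<omega>)" for \<omega>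
      using A(1) by (intro sum.mono_neutral_cong_right) (auto simp: e_def)
    have I: "finite ?I" "indep_vars (\<lambda>_. borel) X ?I"
      using A(1) by (auto intro: indep_vars_subset[OF ind])
    have "(\<Sum>i\<in>?I. (c i)\<^sup>2) \<le> (\<Sum>i\<in>A. (c i)\<^sup>2)"
      using A(1) by (intro sum_mono2) auto
    then have c: "(\<Sum>i\<in>?I. (c i)\<^sup>2) \<le> 1" "(\<Sum>i\<in>?I. (- c i)\<^sup>2) \<le> 1"
      using A(2) by simp_all
    have minus: "(\<Sum>i\<in>?I. - c i * X i \<omega>) = - (\<Sum>i\<in>?I. c i * X i \<omega>)" for \<omega>
      by (simp add: sum_negf)
    have meas: "(\<lambda>\<omega>. \<Sum>i\<in>?I. c i * X i \<omega>) \<in> borel_measurable M"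
      by (intro borel_measurable_sum borel_measurable_times borel_measurable_const X) auto
    note pos = mgf_linear_combination[OF I mgf C c(1)]
    note neg = mgf_linear_combination[OF I mgf C c(2), unfolded minus]
    show ?A ?B ?C
      unfolding eq
      using excess_moment[OF meas pos(1) neg(1) pos(2) neg(2) \<tau>] by auto
  qed
  let ?K = "moment_const C"
  have K: "0 \<le> ?K" "2 * fact 10 * exp C \<le> ?K"
  proof -
    have "geo_const ^ 8 \<le> 1" "0 < geo_const ^ 8"
      using geo_const by (auto intro: power_le_one)
    then have "2 * fact 10 * exp C / 1 \<le> ?K"
      unfolding moment_const_def by (intro divide_left_mono) auto
    then show "2 * fact 10 * exp C \<le> ?K"
      by simp
    show "0 \<le> ?K"
      using geo_const by (simp add: moment_const_def)
  qed
  have coarse: "integrable M (\<lambda>\<omega>. (block_sum (e \<omega>) m 0 / sqrt (2 ^ m))\<^sup>2)"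
    "expectation (\<lambda>\<omega>. (block_sum (e \<omega>) m 0 / sqrt (2 ^ m))\<^sup>2) \<le> ?K"
  proof -
    obtain c A where cA: "finite A" "(\<Sum>i\<in>A. (c i)\<^sup>2) = 1"
      "\<And>x. block_sum x m 0 / sqrt (2 ^ m) = (\<Sum>i\<in>A. c i * x i)"
      using block_sum_linear[of m 0] by metis
    have 0: "excess 0 z = \<bar>z\<bar>" for z
      by (simp add: excess_def)
    show "integrable M (\<lambda>\<omega>. (block_sum (e \<omega>) m 0 / sqrt (2 ^ m))\<^sup>2)"
      "expectation (\<lambda>\<omega>. (block_sum (e \<omega>) m 0 / sqrt (2 ^ m))\<^sup>2) \<le> ?K"
      unfolding cA(3) using excess_linear(1,2)[OF cA(1,2), of 0] K(2) by (auto simp: 0)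
  qed
  have fine: "integrable M (\<lambda>\<omega>. (excess (threshold j p) (haar (e \<omega>) j p))\<^sup>2)"
    "expectation (\<lambda>\<omega>. (excess (threshold j p) (haar (e \<omega>) j p))\<^sup>2) \<le> ?K * cap j p" for j p
  proof -
    obtain c A where cA: "finite A" "(\<Sum>i\<in>A. (c i)\<^sup>2) = 1" "\<And>x. haar x j p = (\<Sum>i\<in>A. c i * x i)"
      using haar_linear[of j p] by metis
    note ex = excess_linear[OF cA(1,2) threshold_nonneg[of j p]]
    show "integrable M (\<lambda>\<omega>. (excess (threshold j p) (haar (e \<omega>) j p))\<^sup>2)"
      unfolding cA(3) by (rule ex)
    show "expectation (\<lambda>\<omega>. (excess (threshold j p) (haar (e \<omega>) j p))\<^sup>2) \<le> ?K * cap j p"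
    proof (cases "block_scale j p < 2 ^ Suc j")
      case True
      then show ?thesis
        unfolding cA(3) cap_def using order_trans[OF ex(2) K(2)] by simp
    next
      case False
      define r where "r = block_scale j p / 2 ^ Suc j"
      have r: "1 \<le> r"
        using False by (simp add: r_def divide_simps del: power_Suc)
      have th: "threshold j p = geo_const * r powr (1 / 4)"
        using False by (simp add: threshold_def r_def)
      \<comment> \<open>The eighth power turns the fourth root into the square that appears in
        \<open>cap\<close>.\<close>
      have "(r powr (1 / 4)) ^ 8 = r\<^sup>2"
        using r by (simp add: powr_power)
      then have "threshold j p ^ 8 = geo_const ^ 8 * r\<^sup>2"
        by (simp add: th power_mult_distrib)
      moreover have "0 < threshold j p"
        using r geo_const by (simp add: th)
      moreover have "cap j p = 1 / r\<^sup>2"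
        using False by (simp add: cap_def r_def power_divide)
      ultimately show ?thesis
        unfolding cA(3) using ex(3) by (simp add: moment_const_def)
    qed
  qed
  show "integrable M (\<lambda>\<omega>. noise_excess m (e \<omega>))"
    unfolding noise_excess_def
    by (intro Bochner_Integration.integrable_add Bochner_Integration.integrable_sum coarse fine)
  have "expectation (\<lambda>\<omega>. noise_excess m (e \<omega>)) =
      expectation (\<lambda>\<omega>. (block_sum (e \<omega>) m 0 / sqrt (2 ^ m))\<^sup>2)
      + (\<Sum>j<m. \<Sum>p<2 ^ (m - Suc j). expectation (\<lambda>\<omega>. (excess (threshold j p) (haar (e \<omega>) j p))\<^sup>2))"
    unfolding noise_excess_def
    by (subst Bochner_Integration.integral_add)
      (auto intro!: Bochner_Integration.integrable_sum coarse fine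
        simp: Bochner_Integration.integral_sum fine)
  also have "\<dots> \<le> ?K + (\<Sum>j<m. \<Sum>p<2 ^ (m - Suc j). ?K * cap j p)"
    by (intro add_mono sum_mono coarse fine)
  also have "\<dots> = ?K * (1 + (\<Sum>j<m. \<Sum>p<2 ^ (m - Suc j). cap j p))"
    by (simp add: sum_distrib_left distrib_left)
  also have "\<dots> \<le> ?K * (1 + (8 * real m * real (card T) + 4 * 2 ^ m / lam\<^sup>2))"
    by (intro mult_left_mono add_left_mono sum_cap_le K)
  finally show "expectation (\<lambda>\<omega>. noise_excess m (e \<omega>))
      \<le> ?K * (1 + 8 * real m * real (card T) + 4 * 2 ^ m / lam\<^sup>2)"
    by (simp add: add.assoc)
qed

end

subsection \<open>The fused lasso\<close>

text \<open>For the least such \<open>m\<close> the power \<open>2 ^ (m - 1)\<close> is below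
  \<open>n\<close>, which gives the second bound. The third then follows from
  \<open>ln 2 \<ge> 1 / 2\<close> and from \<open>ln n \<ge> 1\<close>, which holds since
  \<open>n \<ge> 3\<close>.\<close>

lemma dyadic_length:
  assumes "3 \<le> n"
  obtains m where "n \<le> 2 ^ m" "(2::nat) ^ m \<le> 2 * n" "real m \<le> 3 * ln (real n)"
proof -
  define m where "m = (LEAST m. n \<le> 2 ^ m)"
  have m: "n \<le> 2 ^ m"
    unfolding m_def by (rule LeastI[of _ n]) simp
  have "m \<noteq> 0"
    using m assms by (intro notI) simp
  then obtain k where k: "m = Suc k"
    using not0_implies_Suc by blast
  have "k < m"
    using k by simp
  then have lt: "2 ^ k < n"
    unfolding m_def using not_less_Least by (meson not_le)
  have "ln ((2::real) ^ k) \<le> ln (real n)"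
    using lt assms by (subst ln_le_cancel_iff) (auto simp flip: of_nat_power)
  then have "real k * ln 2 \<le> ln (real n)"
    by (simp add: ln_realpow)
  moreover have "real k * (1 / 2) \<le> real k * ln 2"
    using ln_le_minus_one[of "1 / 2 :: real"] by (intro mult_left_mono) (auto simp: ln_div)
  moreover have "1 \<le> ln (real n)"
    using assms exp_le by (subst ln_ge_iff) auto
  ultimately have "real m \<le> 3 * ln (real n)"
    using k by simp
  then show thesis
    using that[of m] m lt k by simp
qed

section \<open>The estimator in the order of the chain\<close>

lemma sum_permute:
  assumes "distinct vs" "set vs = {1..n}"
  shows "(\<Sum>i=1..n. f i) = (\<Sum>k<n. f (vs ! k))"
proof -
  have "length vs = n"
    using assms distinct_card by fastforce
  then show ?thesis
    using sum.reindex_bij_betw[OF bij_betw_nth[OF assms(1) refl refl], of f] assms(2) by simp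
qed

lemma dfs_fused_lasso_objective_chain:
  assumes "distinct vs" "set vs = {1..n}"
  shows "dfs_fused_lasso_objective n vs lam y \<theta> = 1 / 2 * (\<Sum>k<n. (y (vs ! k) - \<theta> (vs ! k))\<^sup>2)
    + lam * (\<Sum>t=1..<n. \<bar>\<theta> (vs ! t) - \<theta> (vs ! (t - 1))\<bar>)"
  unfolding dfs_fused_lasso_objective_def sum_permute[OF assms] by (simp add: diff1_def permute_def)

text \<open>The minimiser does at least as well as the truth \<open>\<theta>0\<close>; after
  expanding the squares the squared noise cancels.\<close>

lemma fused_lasso_basic_inequality:
  fixes y \<theta>0 \<theta>h :: "nat \<Rightarrow> real"
  assumes vs: "distinct vs" "set vs = {1..n}"
    and min: "is_dfs_fused_lasso n vs lam y \<theta>h"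
  defines "x \<equiv> \<lambda>i. if i < n then \<theta>h (vs ! i) - \<theta>0 (vs ! i) else 0"
    and "e \<equiv> \<lambda>i. if i < n then y (vs ! i) - \<theta>0 (vs ! i) else 0"
    and "a \<equiv> \<lambda>i. \<theta>0 (vs ! i)"
  shows "(\<Sum>i<n. (x i)\<^sup>2) / 2 \<le> (\<Sum>i<n. e i * x i)
      + lam * ((\<Sum>t=1..<n. \<bar>a t - a (t - 1)\<bar>)
        - (\<Sum>t=1..<n. \<bar>(a t + x t) - (a (t - 1) + x (t - 1))\<bar>))"
proof -
  have "dfs_fused_lasso_objective n vs lam y \<theta>h \<le> dfs_fused_lasso_objective n vs lam y \<theta>0"
    using min unfolding is_dfs_fused_lasso_def is_arg_min_def by (meson not_less)
  moreover have fit: "(\<Sum>k<n. (y (vs ! k) - \<theta>h (vs ! k))\<^sup>2)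
      = (\<Sum>i<n. (e i)\<^sup>2) - 2 * (\<Sum>i<n. e i * x i) + (\<Sum>i<n. (x i)\<^sup>2)"
    unfolding sum_distrib_left sum_subtractf[symmetric] sum.distrib[symmetric]
    by (intro sum.cong) (auto simp: e_def x_def power2_eq_square algebra_simps)
  moreover have noise: "(\<Sum>k<n. (y (vs ! k) - \<theta>0 (vs ! k))\<^sup>2) = (\<Sum>i<n. (e i)\<^sup>2)"
    by (intro sum.cong) (auto simp: e_def)
  moreover have tv: "(\<Sum>t=1..<n. \<bar>\<theta>h (vs ! t) - \<theta>h (vs ! (t - 1))\<bar>)
      = (\<Sum>t=1..<n. \<bar>(a t + x t) - (a (t - 1) + x (t - 1))\<bar>)"
    by (intro sum.cong) (auto simp: a_def x_def)
  ultimately show ?thesis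
    unfolding dfs_fused_lasso_objective_chain[OF vs] fit noise tv
    unfolding a_def right_diff_distrib by argo
qed

lemma spaced_jumps_dfs:
  assumes n: "1 \<le> n" and lam: "0 < lam"
  shows "spaced_jumps n (jump_spacing n vs \<theta>) (jumps n vs \<theta>) lam"
proof
  have fin: "finite (jumps n vs \<theta> \<union> {0, n})"
    by (simp add: jumps_def)
  show "jumps n vs \<theta> \<subseteq> {1..<n}"
    by (auto simp: jumps_def)
  show "jump_spacing n vs \<theta> \<le> j - i"
    if "i \<in> insert 0 (insert n (jumps n vs \<theta>))" "j \<in> insert 0 (insert n (jumps n vs \<theta>))" "i < j" for i j
    using min_distance_le[OF fin, of j i] that by (auto simp: jump_spacing_def nat_diff_distrib)
  show "1 \<le> jump_spacing n vs \<theta>"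
    using min_distance_pos[OF fin, of 0 n] n by (simp add: jump_spacing_def)
qed (use n lam in auto)

text \<open>With \<open>m \<le> 3 * ln n\<close> and \<open>card T \<le> 4 * s\<close> the level sum
  costs \<open>96 * s * ln n\<close>, and the coefficient of the constant function makes it 97. The
  term \<open>8 / c\<^sup>2\<close> comes from \<open>2 ^ m \<le> 2 * n\<close> and the lower bound
  on \<open>lam\<close>.\<close>

definition noise_const :: "real \<Rightarrow> real \<Rightarrow> real \<Rightarrow> real" where
  "noise_const M \<sigma> c = moment_const (2 * exp_moment_bound M \<sigma>) * (97 + 8 / c\<^sup>2)"

text \<open>Here 64 is \<open>32 * 2\<close> because of \<open>card S \<le> 2 * s\<close>, the term
  \<open>8 * c\<^sup>2\<close> comes from \<open>lam\<^sup>2 / W\<close>, and 4 from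
  \<open>2 * (1 + ln n) \<le> 4 * ln n\<close>.\<close>

definition bias_const :: "real \<Rightarrow> real" where
  "bias_const c = 64 * (8 * c\<^sup>2 + 4)"

text \<open>The estimator is given pointwise as a minimiser, without a measurability assumption, so
  the error is dominated by an integrable \<open>R\<close> to which Markov's inequality can be
  applied.\<close>

lemma fused_lasso_error_dominated:
  assumes const: "M > 0" "\<sigma> > 0" "c1 > 0"
    and P: "prob_space P" and iid: "iid_sub_gaussian P M \<sigma> n \<epsilon>"
    and G: "connected_graph {1..n} E" "dfs_ordering {1..n} E vs" "\<theta>0 \<in> BD E s"
    and s: "s > 0" and n3: "3 \<le> n"
    and y: "\<And>\<omega> i. \<omega> \<in> space P \<Longrightarrow> i \<in> {1..n} \<Longrightarrow> y \<omega> i = \<theta>0 i + \<epsilon> i \<omega>"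
    and min: "\<And>\<omega>. \<omega> \<in> space P \<Longrightarrow> is_dfs_fused_lasso n vs lam (y \<omega>) (\<theta>hat \<omega>)"
    and W: "W = jump_spacing n vs \<theta>0"
    and bounds: "c1 * (real n * real W) powr (1 / 4) \<le> lam" "lam \<le> c2 * (real n * real W) powr (1 / 4)"
  defines "r \<equiv> real s * (ln (real n) + sqrt (real n / real W))"
  shows "\<exists>R. integrable P R \<and> (\<forall>\<omega>. 0 \<le> R \<omega>) \<and> integral\<^sup>L P R \<le> noise_const M \<sigma> c1 * r \<and>
    (\<forall>\<omega>\<in>space P. real n * mean_sq n (\<lambda>i. \<theta>hat \<omega> i - \<theta>0 i) \<le> 8 * R \<omega> + bias_const c2 * r)"
proof -
  interpret prob_space P by fact
  note vs = dfs_ordering_set[OF G(1,2)]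
  have len: "length vs = n"
    using vs distinct_card by fastforce
  define S where "S = jumps n vs \<theta>0"
  have W1: "1 \<le> W"
    using min_distance_pos[of "jumps n vs \<theta>0 \<union> {0, n}" 0 n] n3
    by (simp add: W jump_spacing_def jumps_def)
  \<comment> \<open>The order of \<open>lam\<close>. Its square is the geometric mean of
    \<open>n\<close> and \<open>W\<close>, so \<open>n / g\<^sup>2\<close> and
    \<open>g\<^sup>2 / W\<close> both equal \<open>sqrt (n / W)\<close>: noise and bias
    balance.\<close>
  define g where "g = (real n * real W) powr (1 / 4)"
  have g: "0 < g" "g\<^sup>2 = sqrt (real n * real W)"
  proof -
    show "0 < g"
      using n3 W1 by (simp add: g_def)
    have "g\<^sup>2 = (real n * real W) powr (1 / 4 + 1 / 4)"
      by (simp only: g_def power2_eq_square powr_add)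
    then show "g\<^sup>2 = sqrt (real n * real W)"
      by (simp add: powr_half_sqrt)
  qed
  have lam0: "0 < lam"
    using less_le_trans[OF mult_pos_pos[OF const(3) g(1)]] bounds(1) by (simp add: g_def)
  interpret spaced_jumps n W S lam
    unfolding W S_def by (rule spaced_jumps_dfs) (use n3 lam0 in auto)
  define q where "q = sqrt (real n / real W)"
  have q: "0 \<le> q"
    by (simp add: q_def)
  have qg: "q * g\<^sup>2 = real n" "g\<^sup>2 = q * real W"
    using W1 real_div_sqrt[of "real W"] unfolding g(2) q_def
    by (simp_all add: real_sqrt_mult real_sqrt_divide flip: times_divide_eq_right)
  have n_lam: "real n / lam\<^sup>2 \<le> q / c1\<^sup>2"
  proof -
    have "c1\<^sup>2 * g\<^sup>2 \<le> lam\<^sup>2"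
      unfolding power_mult_distrib[symmetric]
      using bounds(1)[folded g_def] const(3) g(1) by (intro power_mono) auto
    then have "real n / lam\<^sup>2 \<le> real n / (c1\<^sup>2 * g\<^sup>2)"
      using const(3) g(1) lam0 by (intro divide_left_mono) auto
    also have "\<dots> = q / c1\<^sup>2"
      unfolding qg(1)[symmetric] using g(1) by simp
    finally show ?thesis .
  qed
  have lam_W: "lam\<^sup>2 / real W \<le> c2\<^sup>2 * q"
  proof -
    have "lam\<^sup>2 \<le> c2\<^sup>2 * g\<^sup>2"
      unfolding power_mult_distrib[symmetric]
      using bounds(2)[folded g_def] lam0 by (intro power_mono) auto
    then have "lam\<^sup>2 / real W \<le> c2\<^sup>2 * g\<^sup>2 / real W"
      by (intro divide_right_mono) auto
    also have "\<dots> = c2\<^sup>2 * q"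
      unfolding qg(2) using W1 by simp
    finally show ?thesis .
  qed
  have ln1: "1 \<le> ln (real n)"
    using n3 exp_le by (subst ln_ge_iff) auto
  have s1: "1 \<le> real s"
    using s by simp
  have card_S: "real (card S) \<le> 2 * real s"
    using card_jumps_dfs_le[OF G] by (simp add: S_def)
  have card_T: "real (card T) \<le> 4 * real s"
  proof -
    have "card T \<le> card S + 2"
      unfolding T_def using card_insert_le_m1[of "card S + 2" "insert n S" 0]
        card_insert_le_m1[of "card S + 1" S n] by simp
    then show ?thesis
      using card_S s1 by linarith
  qed
  obtain m where m: "n \<le> 2 ^ m" "(2::nat) ^ m \<le> 2 * n" "real m \<le> 3 * ln (real n)"
    using dyadic_length[OF n3] by blast
  define C where "C = 2 * exp_moment_bound M \<sigma>"
  have C: "0 \<le> C"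
    using exp_moment_bound_ge_1[OF const(1,2)] by (simp add: C_def)
  define X where "X i = \<epsilon> (vs ! i)" for i
  have nth: "vs ! i \<in> {1..n}" if "i < n" for i
    using that vs len nth_mem by blast
  have bij: "bij_betw (\<lambda>i. vs ! i) {..<n} {1..n}"
    using bij_betw_nth[OF vs(1) refl refl] vs len by simp
  have ind: "indep_vars (\<lambda>_. borel) X {..<n}"
    unfolding X_def
  proof (rule indep_vars_reindex)
    show "indep_vars (\<lambda>_. borel) \<epsilon> ((\<lambda>i. vs ! i) ` {..<n})"
      using iid unfolding bij_betw_imp_surj_on[OF bij] iid_sub_gaussian_def by blast
    show "inj_on (\<lambda>i. vs ! i) {..<n}"
      using bij by (rule bij_betw_imp_inj_on)
  qed
  have X: "integrable P (X i)" "expectation (X i) = 0"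
      "\<And>u. u \<ge> 0 \<Longrightarrow> prob {\<omega> \<in> space P. \<bar>X i \<omega>\<bar> > u} \<le> M * exp (- u\<^sup>2 / (2 * \<sigma>\<^sup>2))" if "i < n" for i
    using iid nth[OF that] by (auto simp: iid_sub_gaussian_def X_def)
  have mgf: "integrable P (\<lambda>\<omega>. exp (t * X i \<omega>))"
      "expectation (\<lambda>\<omega>. exp (t * X i \<omega>)) \<le> exp (C * t\<^sup>2)" if "i < n" "\<bar>t\<bar> \<le> 1" for i t
    using mgf_sub_gaussian[OF const(1,2) X[OF that(1)] that(2)] by (simp_all add: C_def)
  define e where "e \<omega> i = (if i < n then X i \<omega> else 0)" for \<omega> i
  define R where "R \<omega> = noise_excess m (e \<omega>)" for \<omega>
  note moment = noise_excess_moment[OF P ind mgf C, of m, folded e_def R_def]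
  show ?thesis
  proof (intro exI[of _ R] conjI allI ballI)
    show "integrable P R"
      using moment(1) by (simp add: R_def[abs_def] e_def[abs_def])
    show "0 \<le> R \<omega>" for \<omega>
      unfolding R_def noise_excess_def by (intro add_nonneg_nonneg sum_nonneg) auto
    have "integral\<^sup>L P R \<le> moment_const C * (1 + 8 * real m * real (card T) + 4 * 2 ^ m / lam\<^sup>2)"
      using moment(2) by (simp add: R_def[abs_def] e_def[abs_def])
    also have "\<dots> \<le> moment_const C * ((97 + 8 / c1\<^sup>2) * r)"
    proof (intro mult_left_mono)
      have "(97 + 8 / c1\<^sup>2) * r = 97 * (real s * ln (real n)) + 97 * (real s * q)
          + 8 / c1\<^sup>2 * (real s * ln (real n)) + 8 / c1\<^sup>2 * (real s * q)"
        unfolding r_def q_def[symmetric] by (simp only: distrib_left distrib_right)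
      moreover have "8 * real m * real (card T) \<le> 8 * (3 * ln (real n)) * (4 * real s)"
        using m(3) card_T ln1 by (intro mult_mono) auto
      then have "8 * real m * real (card T) \<le> 96 * (real s * ln (real n))"
        by (simp add: mult_ac)
      moreover have "4 * 2 ^ m / lam\<^sup>2 \<le> 8 / c1\<^sup>2 * (real s * q)"
      proof -
        have "(2::real) ^ m \<le> 2 * real n"
          using m(2) by (metis of_nat_le_iff of_nat_mult of_nat_numeral of_nat_power)
        then have "4 * 2 ^ m / lam\<^sup>2 \<le> 8 * (real n / lam\<^sup>2)"
          using lam0 by (simp add: divide_simps)
        also have "\<dots> \<le> 8 * (q / c1\<^sup>2)"
          using n_lam by simp
        also have "\<dots> \<le> 8 / c1\<^sup>2 * (real s * q)"
          using s1 q mult_right_mono[OF s1 q] by (simp add: divide_right_mono)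
        finally show ?thesis .
      qed
      moreover have "1 \<le> real s * ln (real n)"
        using mult_mono[OF s1 ln1] s1 by simp
      moreover have "0 \<le> real s * q" "0 \<le> 8 / c1\<^sup>2 * (real s * ln (real n))"
        using s1 q ln1 by auto
      ultimately show "1 + 8 * real m * real (card T) + 4 * 2 ^ m / lam\<^sup>2 \<le> (97 + 8 / c1\<^sup>2) * r"
        by linarith
      show "0 \<le> moment_const C"
        using geo_const by (simp add: moment_const_def)
    qed
    finally show "integral\<^sup>L P R \<le> noise_const M \<sigma> c1 * r"
      by (simp add: noise_const_def C_def)
  next
    fix \<omega>
    assume \<omega>: "\<omega> \<in> space P"
    define a where "a i = \<theta>0 (vs ! i)" for i
    define x where "x i = (if i < n then \<theta>hat \<omega> (vs ! i) - \<theta>0 (vs ! i) else 0)" for i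
    have e_eq: "e \<omega> = (\<lambda>i. if i < n then y \<omega> (vs ! i) - \<theta>0 (vs ! i) else 0)"
      using y[OF \<omega> nth] by (auto simp: e_def X_def)
    have "(\<Sum>i<n. (x i)\<^sup>2) \<le> 8 * R \<omega>
        + 32 * real (card S) * (8 * (lam\<^sup>2 / real W) + 2 * (1 + ln (real n)))"
      unfolding R_def
    proof (rule estimation_error_le[OF m(1)])
      show "S = {t \<in> {1..<n}. a t \<noteq> a (t - 1)}"
        by (auto simp: S_def jumps_def diff1_def permute_def a_def)
      show "(\<Sum>i<n. (x i)\<^sup>2) / 2 \<le> (\<Sum>i<n. e \<omega> i * x i)
          + lam * ((\<Sum>t=1..<n. \<bar>a t - a (t - 1)\<bar>)
            - (\<Sum>t=1..<n. \<bar>(a t + x t) - (a (t - 1) + x (t - 1))\<bar>))"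
        using fused_lasso_basic_inequality[OF vs min[OF \<omega>], of \<theta>0]
        unfolding e_eq a_def x_def .
    qed (auto simp: x_def e_def)
    also have "32 * real (card S) * (8 * (lam\<^sup>2 / real W) + 2 * (1 + ln (real n)))
        \<le> 32 * (2 * real s) * (8 * (c2\<^sup>2 * q) + 2 * (ln (real n) + ln (real n)))"
      using card_S lam_W ln1 by (intro mult_mono add_mono) auto
    also have "\<dots> \<le> bias_const c2 * r"
    proof -
      have "0 \<le> real s * (8 * c2\<^sup>2 * ln (real n) + 4 * q)"
        using s1 q ln1 by auto
      then show ?thesis
        unfolding r_def q_def[symmetric] bias_const_def by (simp add: algebra_simps)
    qed
    also have "(\<Sum>i<n. (x i)\<^sup>2) = real n * mean_sq n (\<lambda>i. \<theta>hat \<omega> i - \<theta>0 i)"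
      using n3 unfolding mean_sq_def sum_permute[OF vs] by (simp add: x_def)
    finally show "real n * mean_sq n (\<lambda>i. \<theta>hat \<omega> i - \<theta>0 i) \<le> 8 * R \<omega> + bias_const c2 * r"
      by simp
  qed
qed

text \<open>The measurable cover is the event that \<open>R\<close> is large; outside it the
  pointwise domination bounds the error.\<close>

lemma fused_lasso_error_tail:
  assumes const: "M > 0" "\<sigma> > 0" "c1 > 0"
    and P: "prob_space P" and iid: "iid_sub_gaussian P M \<sigma> n \<epsilon>"
    and G: "connected_graph {1..n} E" "dfs_ordering {1..n} E vs" "\<theta>0 \<in> BD E s"
    and s: "s > 0" and n: "3 \<le> n"
    and y: "\<And>\<omega> i. \<omega> \<in> space P \<Longrightarrow> i \<in> {1..n} \<Longrightarrow> y \<omega> i = \<theta>0 i + \<epsilon> i \<omega>"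
    and min: "\<And>\<omega>. \<omega> \<in> space P \<Longrightarrow> is_dfs_fused_lasso n vs lam (y \<omega>) (\<theta>hat \<omega>)"
    and W: "W = jump_spacing n vs \<theta>0"
    and lam: "c1 * (real n * real W) powr (1 / 4) \<le> lam" "lam \<le> c2 * (real n * real W) powr (1 / 4)"
    and \<eta>: "\<eta> > 0"
  defines "r \<equiv> real s / real n * (ln (real n) + sqrt (real n / real W))"
  shows "\<exists>A\<in>sets P. {\<omega> \<in> space P. mean_sq n (\<lambda>i. \<theta>hat \<omega> i - \<theta>0 i)
      > (8 * (noise_const M \<sigma> c1 / \<eta>) + bias_const c2) * r} \<subseteq> A \<and> measure P A \<le> \<eta>"
proof -
  interpret prob_space P by fact
  define b where "b = real s * (ln (real n) + sqrt (real n / real W))"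
  obtain R where R: "integrable P R" "\<And>\<omega>. 0 \<le> R \<omega>" "integral\<^sup>L P R \<le> noise_const M \<sigma> c1 * b"
    "\<And>\<omega>. \<omega> \<in> space P \<Longrightarrow>
      real n * mean_sq n (\<lambda>i. \<theta>hat \<omega> i - \<theta>0 i) \<le> 8 * R \<omega> + bias_const c2 * b"
    using fused_lasso_error_dominated[OF const P iid G s n y min W lam, folded b_def] by blast
  have b: "0 < b"
    using s n by (auto simp: b_def intro!: mult_pos_pos add_pos_nonneg)
  have K: "0 < noise_const M \<sigma> c1"
    using geo_const const(3) unfolding noise_const_def moment_const_def
    by (intro mult_pos_pos divide_pos_pos add_pos_nonneg) auto
  \<comment> \<open>The level at which Markov's bound for \<open>R\<close> equals
    \<open>\<eta>\<close>.\<close>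
  define u where "u = noise_const M \<sigma> c1 * b / \<eta>"
  have u: "0 < u"
    using b K \<eta> by (simp add: u_def)
  have [measurable]: "R \<in> borel_measurable P"
    using R(1) by auto
  let ?A = "{\<omega> \<in> space P. u \<le> R \<omega>}"
  have "measure P ?A \<le> integral\<^sup>L P R / u"
    by (rule integral_Markov_inequality_measure[where A = "{}"]) (use R u in auto)
  also have "\<dots> \<le> noise_const M \<sigma> c1 * b / u"
    using R(3) u by (intro divide_right_mono) auto
  also have "\<dots> = \<eta>"
    using K b \<eta> by (simp add: u_def)
  finally have "measure P ?A \<le> \<eta>" .
  moreover have "u \<le> R \<omega>"
    if \<omega>: "\<omega> \<in> space P" and gt: "mean_sq n (\<lambda>i. \<theta>hat \<omega> i - \<theta>0 i)
      > (8 * (noise_const M \<sigma> c1 / \<eta>) + bias_const c2) * r" for \<omega>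
  proof -
    have "real n * ((8 * (noise_const M \<sigma> c1 / \<eta>) + bias_const c2) * r)
        < real n * mean_sq n (\<lambda>i. \<theta>hat \<omega> i - \<theta>0 i)"
      using gt n by (intro mult_strict_left_mono) auto
    also have "\<dots> \<le> 8 * R \<omega> + bias_const c2 * b"
      by (rule R(4)[OF \<omega>])
    also have "real n * ((8 * (noise_const M \<sigma> c1 / \<eta>) + bias_const c2) * r) = 8 * u + bias_const c2 * b"
      using n by (simp add: r_def b_def u_def algebra_simps add_divide_distrib)
    finally show ?thesis
      by simp
  qed
  ultimately show ?thesis
    by (intro bexI[of _ ?A]) auto
qed

theorem theorem5:
  fixes P :: "nat \<Rightarrow> 'w measure"
    and M \<sigma> :: real
    and E :: "nat \<Rightarrow> nat set set"
    and s :: "nat \<Rightarrow> nat"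
    and \<theta>0 :: "nat \<Rightarrow> nat \<Rightarrow> real"
    and \<epsilon> :: "nat \<Rightarrow> nat \<Rightarrow> 'w \<Rightarrow> real"
    and y \<theta>hat :: "nat \<Rightarrow> 'w \<Rightarrow> nat \<Rightarrow> real"
    and vs :: "nat \<Rightarrow> nat list"
    and lam :: "nat \<Rightarrow> real"
    and W :: "nat \<Rightarrow> nat"
  assumes "M > 0" and "\<sigma> > 0"
    and "\<And>n. n \<ge> 1 \<Longrightarrow> prob_space (P n)"
    and "\<And>n. n \<ge> 1 \<Longrightarrow> iid_sub_gaussian (P n) M \<sigma> n (\<epsilon> n)"
    and "\<And>n. n \<ge> 1 \<Longrightarrow> connected_graph {1..n} (E n)"
    and "\<And>n. n \<ge> 1 \<Longrightarrow> s n > 0"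
    and "\<And>n. n \<ge> 1 \<Longrightarrow> \<theta>0 n \<in> BD (E n) (s n)"
    and "\<And>n. n \<ge> 1 \<Longrightarrow> dfs_ordering {1..n} (E n) (vs n)"
    and "\<And>n. n \<ge> 1 \<Longrightarrow> lam n \<ge> 0"
    and "\<And>n \<omega> i. n \<ge> 1 \<Longrightarrow> \<omega> \<in> space (P n) \<Longrightarrow> i \<in> {1..n} \<Longrightarrow> y n \<omega> i = \<theta>0 n i + \<epsilon> n i \<omega>"
    and "\<And>n \<omega>. n \<ge> 1 \<Longrightarrow> \<omega> \<in> space (P n) \<Longrightarrow>
           is_dfs_fused_lasso n (vs n) (lam n) (y n \<omega>) (\<theta>hat n \<omega>)"
    and "\<And>n. n \<ge> 1 \<Longrightarrow> W n = jump_spacing n (vs n) (\<theta>0 n)"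
  shows "(lam \<in> \<Theta>(\<lambda>n. (real n * real (W n)) powr (1 / 4)) \<longrightarrow>
           bounded_in_prob P (\<lambda>n \<omega>. mean_sq n (\<lambda>i. \<theta>hat n \<omega> i - \<theta>0 n i))
             (\<lambda>n. real (s n) / real n *
                ((ln (real (s n)) + ln (ln (real n))) * ln (real n) + sqrt (real n / real (W n)))))
       \<and> ((\<lambda>n. real (W n)) \<in> \<Theta>(\<lambda>n. real n / real (s n)) \<longrightarrow>
           lam \<in> \<Theta>(\<lambda>n. sqrt (real n) * real (s n) powr (- 1 / 4)) \<longrightarrow>
           bounded_in_prob P (\<lambda>n \<omega>. mean_sq n (\<lambda>i. \<theta>hat n \<omega> i - \<theta>0 n i))
             (\<lambda>n. real (s n) * (ln (real (s n)) + ln (ln (real n))) * ln (real n) / real n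
                + real (s n) powr (3 / 2) / real n))"
proof -
  define rate where "rate n = real (s n) / real n * (ln (real n) + sqrt (real n / real (W n)))" for n
  have W_pos: "1 \<le> W n" if "1 \<le> n" for n
    using assms(12)[OF that] spaced_jumps.W[OF spaced_jumps_dfs[OF that, of 1 "vs n" "\<theta>0 n"]] by simp
  \<comment> \<open>Both claims reduce to this: an order \<open>b\<close> is admissible as soon as
    it eventually dominates \<open>rate\<close> up to a constant.\<close>
  have bounded: "bounded_in_prob P (\<lambda>n \<omega>. mean_sq n (\<lambda>i. \<theta>hat n \<omega> i - \<theta>0 n i)) b"
    if lam: "lam \<in> \<Theta>(\<lambda>n. (real n * real (W n)) powr (1 / 4))"
      and b: "\<forall>\<^sub>F n in sequentially. rate n \<le> c * b n" "0 < c" for b c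
    unfolding bounded_in_prob_def
  proof (intro allI impI)
    fix \<eta> :: real
    assume \<eta>: "0 < \<eta>"
    obtain c1 where c1: "c1 > 0"
      "\<forall>\<^sub>F n in sequentially. norm (lam n) \<ge> c1 * norm ((real n * real (W n)) powr (1 / 4))"
      using bigthetaD2[OF lam] by (rule landau_omega.bigE)
    obtain c2 where c2: "c2 > 0"
      "\<forall>\<^sub>F n in sequentially. norm (lam n) \<le> c2 * norm ((real n * real (W n)) powr (1 / 4))"
      using bigthetaD1[OF lam] by (rule landau_o.bigE)
    define k where "k = 8 * (noise_const M \<sigma> c1 / \<eta>) + bias_const c2"
    have k: "0 < k"
    proof -
      have "0 \<le> noise_const M \<sigma> c1 / \<eta>"
        using \<eta> geo_const by (simp add: noise_const_def moment_const_def)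
      moreover have "0 < bias_const c2"
        by (simp add: bias_const_def add_nonneg_pos)
      ultimately show ?thesis
        by (simp add: k_def)
    qed
    show "\<exists>C>0. \<forall>\<^sub>F n in sequentially. \<exists>A\<in>sets (P n).
        {\<omega> \<in> space (P n). \<bar>mean_sq n (\<lambda>i. \<theta>hat n \<omega> i - \<theta>0 n i)\<bar> > C * \<bar>b n\<bar>} \<subseteq> A
          \<and> measure (P n) A \<le> \<eta>"
    proof (intro exI[of _ "k * c"] conjI)
      show "0 < k * c"
        using k b(2) by simp
      show "\<forall>\<^sub>F n in sequentially. \<exists>A\<in>sets (P n).
          {\<omega> \<in> space (P n). \<bar>mean_sq n (\<lambda>i. \<theta>hat n \<omega> i - \<theta>0 n i)\<bar> > k * c * \<bar>b n\<bar>} \<subseteq> A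
            \<and> measure (P n) A \<le> \<eta>"
        using c1(2) c2(2) b(1) eventually_ge_at_top[of 3]
      proof eventually_elim
        case (elim n)
        have n: "1 \<le> n"
          using elim by simp
        have lam_n: "c1 * (real n * real (W n)) powr (1 / 4) \<le> lam n"
          "lam n \<le> c2 * (real n * real (W n)) powr (1 / 4)"
          using elim assms(9)[OF n] by auto
        obtain A where A: "A \<in> sets (P n)" "measure (P n) A \<le> \<eta>"
          "{\<omega> \<in> space (P n). mean_sq n (\<lambda>i. \<theta>hat n \<omega> i - \<theta>0 n i) > k * rate n} \<subseteq> A"
          using fused_lasso_error_tail[OF assms(1,2) c1(1) assms(3,4,5,8,7,6)[OF n] _ assms(10,11)[OF n]
              assms(12)[OF n] lam_n \<eta>] elim
          unfolding k_def rate_def by blast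
        have "k * rate n \<le> k * (c * \<bar>b n\<bar>)"
          using elim k b(2) by (intro mult_left_mono) (auto intro: order_trans mult_left_mono)
        moreover have "0 \<le> mean_sq n x" for x
          by (simp add: mean_sq_def sum_nonneg)
        ultimately have "{\<omega> \<in> space (P n). \<bar>mean_sq n (\<lambda>i. \<theta>hat n \<omega> i - \<theta>0 n i)\<bar> > k * c * \<bar>b n\<bar>}
            \<subseteq> {\<omega> \<in> space (P n). mean_sq n (\<lambda>i. \<theta>hat n \<omega> i - \<theta>0 n i) > k * rate n}"
          by (auto simp: mult.assoc)
        then show ?case
          using A by blast
      qed
    qed
  qed
  \<comment> \<open>Beyond \<open>exp (exp 1)\<close> the iterated logarithm is at least 1, and
    \<open>ln s\<close> is nonnegative as \<open>s \<ge> 1\<close>, so the stated logarithmic factor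
    dominates \<open>ln n\<close>.\<close>
  have log: "\<forall>\<^sub>F n in sequentially. 1 \<le> n \<and> ln (real n) \<le> (ln (real (s n)) + ln (ln (real n))) * ln (real n)"
    using eventually_ge_at_top[of "nat \<lceil>exp (exp 1 :: real)\<rceil>"]
  proof eventually_elim
    case (elim n)
    have ee: "exp (exp 1 :: real) \<le> real n"
      using elim by linarith
    then have n: "0 < real n"
      by (rule less_le_trans[OF exp_gt_zero])
    then have "exp 1 \<le> ln (real n)"
      using ee by (simp add: ln_ge_iff)
    then have "0 < ln (real n)" "1 \<le> ln (ln (real n))"
      using less_le_trans[OF exp_gt_zero] by (auto simp: ln_ge_iff)
    moreover have "0 \<le> ln (real (s n))"
      using assms(6)[of n] n by simp
    ultimately have "1 * ln (real n) \<le> (ln (real (s n)) + ln (ln (real n))) * ln (real n)"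
      by (intro mult_right_mono) auto
    then show ?case
      using n by simp
  qed
  show ?thesis
  proof (intro conjI impI)
    assume "lam \<in> \<Theta>(\<lambda>n. (real n * real (W n)) powr (1 / 4))"
    then show "bounded_in_prob P (\<lambda>n \<omega>. mean_sq n (\<lambda>i. \<theta>hat n \<omega> i - \<theta>0 n i))
        (\<lambda>n. real (s n) / real n *
          ((ln (real (s n)) + ln (ln (real n))) * ln (real n) + sqrt (real n / real (W n))))"
    proof (rule bounded[where c = 1])
      show "\<forall>\<^sub>F n in sequentially. rate n \<le> 1 * (real (s n) / real n *
          ((ln (real (s n)) + ln (ln (real n))) * ln (real n) + sqrt (real n / real (W n))))"
        using log
      proof eventually_elim
        case (elim n)
        then show ?case
          unfolding rate_def mult_1 by (intro mult_left_mono add_right_mono) auto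
      qed
    qed simp
  next
    assume W_theta: "(\<lambda>n. real (W n)) \<in> \<Theta>(\<lambda>n. real n / real (s n))"
      and lam: "lam \<in> \<Theta>(\<lambda>n. sqrt (real n) * real (s n) powr (- 1 / 4))"
    \<comment> \<open>For \<open>W\<close> of order \<open>n / s\<close> the fourth root of
      \<open>n * W\<close> has the order prescribed for \<open>lam\<close> here, so the tuning is
      the same as in the first claim.\<close>
    have "(\<lambda>n. \<bar>real n * real (W n)\<bar> powr (1 / 4))
        \<in> \<Theta>(\<lambda>n. \<bar>real n * (real n / real (s n))\<bar> powr (1 / 4))"
      by (intro bigtheta_powr landau_theta.mult W_theta) auto
    also have "(\<lambda>n. \<bar>real n * (real n / real (s n))\<bar> powr (1 / 4))
        \<in> \<Theta>(\<lambda>n. sqrt (real n) * real (s n) powr (- 1 / 4))"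
    proof (intro bigthetaI_cong eventually_mono[OF eventually_ge_at_top[of 1]])
      fix n :: nat
      assume n: "1 \<le> n"
      have "(real n * real n) powr (1 / 4) = real n powr (1 / 4 + 1 / 4)"
        using n by (simp only: powr_mult powr_add)
      also have "\<dots> = sqrt (real n)"
        by (simp add: powr_half_sqrt)
      finally show "\<bar>real n * (real n / real (s n))\<bar> powr (1 / 4)
          = sqrt (real n) * real (s n) powr (- 1 / 4)"
        using n assms(6)[OF n] by (simp add: powr_divide powr_minus_divide)
    qed
    finally have "(\<lambda>n. (real n * real (W n)) powr (1 / 4))
        \<in> \<Theta>(\<lambda>n. sqrt (real n) * real (s n) powr (- 1 / 4))"
      by simp
    then have lam': "lam \<in> \<Theta>(\<lambda>n. (real n * real (W n)) powr (1 / 4))"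
      using lam bigtheta_sym landau_theta.trans by blast
    obtain c where c: "c > 0"
      "\<forall>\<^sub>F n in sequentially. norm (real (W n)) \<ge> c * norm (real n / real (s n))"
      using bigthetaD2[OF W_theta] by (rule landau_omega.bigE)
    \<comment> \<open>The lower bound on \<open>W\<close> gives
      \<open>sqrt (n / W) \<le> sqrt s / sqrt c\<close>; the maximum with 1 allows the factor
      \<open>d\<close> in front of the logarithmic term too.\<close>
    define d where "d = max 1 (1 / sqrt c)"
    have d: "1 \<le> d" "1 / sqrt c \<le> d"
      by (auto simp: d_def)
    show "bounded_in_prob P (\<lambda>n \<omega>. mean_sq n (\<lambda>i. \<theta>hat n \<omega> i - \<theta>0 n i))
        (\<lambda>n. real (s n) * (ln (real (s n)) + ln (ln (real n))) * ln (real n) / real n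
          + real (s n) powr (3 / 2) / real n)"
    proof (rule bounded[OF lam', of d])
      show "\<forall>\<^sub>F n in sequentially. rate n
          \<le> d * (real (s n) * (ln (real (s n)) + ln (ln (real n))) * ln (real n) / real n
            + real (s n) powr (3 / 2) / real n)"
        using log c(2)
      proof eventually_elim
        case (elim n)
        then have n: "1 \<le> n"
          by simp
        let ?L = "(ln (real (s n)) + ln (ln (real n))) * ln (real n)"
        have s: "0 < real (s n)"
          using assms(6)[OF n] by simp
        have "real n / real (W n) \<le> real (s n) / c"
          using elim(2) n W_pos[OF n] s c(1) by (simp add: field_simps)
        then have "sqrt (real n / real (W n)) \<le> 1 / sqrt c * sqrt (real (s n))"
          using real_sqrt_le_mono by (fastforce simp: real_sqrt_divide)
        also have "\<dots> \<le> d * sqrt (real (s n))"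
          using d(2) by (intro mult_right_mono) auto
        finally have 1: "sqrt (real n / real (W n)) \<le> d * sqrt (real (s n))" .
        have "1 * ln (real n) \<le> d * ?L"
          using d(1) elim(1) n by (intro mult_mono) auto
        with 1 have "rate n \<le> real (s n) / real n * (d * ?L + d * sqrt (real (s n)))"
          unfolding rate_def by (intro mult_left_mono add_mono) auto
        also have "\<dots> = d * (real (s n) * ?L / real n + real (s n) * sqrt (real (s n)) / real n)"
          by (simp add: algebra_simps add_divide_distrib)
        also have "real (s n) * sqrt (real (s n)) = real (s n) powr (1 + 1 / 2)"
          unfolding powr_add using s by (simp add: powr_half_sqrt)
        finally show ?case
          by (simp add: mult.assoc)
      qed
    qed (use d in linarith)
  qed
qed

end
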